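(* Let $d, J \in \mathbb{N}$ and let $\rho_{\mathrm{ref}} \in C^1(\mathbb{R}^d;\mathbb{R}_{>0})$ be a strictly positive probability density function with finite first moment, $M := \int_{\mathbb{R}^d} \|x\| \, \rho_{\mathrm{ref}}(x)\, \mathrm{d}x < \infty$. For $j=1,\dots,J$ let $a_j \in \mathbb{R}^d$, let $A_j \in \mathbb{R}^{d\times d}$ be symmetric and positive definite, and let $w_j \ge 0$ with $\sum_{j=1}^J w_j = 1$. Let $$\rho_{\mathrm{tar}}(x) = \sum_{j=1}^{J} w_j\, |\det A_j|^{-1}\, \rho_{\mathrm{ref}}(A_j^{-1}(x-a_j)),$$ and let $\mathbb{P}_{\mathrm{ref}}$ and $\mathbb{P}_{\mathrm{tar}}$ denote the probability distributions on $\mathbb{R}^d$ with densities $\rho_{\mathrm{ref}}$ and $\rho_{\mathrm{tar}}$, respectively. Further, for $j=1,\dots,J$ and $t\in[0,1]$, let $$A_{j,t} := t A_j + (1-t)\, \mathrm{Id}_d,$$ $$\rho_{j,t}(x) := |\det A_{j,t}|^{-1}\, \rho_{\mathrm{ref}}(A_{j,t}^{-1}(x-ta_j)),$$ $$v_{j,t}(x) := a_j + (A_j - \mathrm{Id}_d)A_{j,t}^{-1}(x-ta_j),$$ and let the densities $\rho_t := \sum_{j=1}^{J} w_j \rho_{j,t}$, $t\in[0,1]$, define probability distributions $\mathbb{P}_t$ on $\mathbb{R}^d$. Then, for $\mathbb{P}_{\mathrm{ref}}$-almost every $x_0\in\mathbb{R}^d$, the ODE $$\dot{x}(t) = v_t(x(t)),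 \qquad x(0)=x_0, \qquad v_t := \rho_t^{-1}\sum_{j=1}^{J} w_j \rho_{j,t} v_{j,t}, \qquad t\in[0,1],$$ admits a globally defined solution on $[0,1]$ and, for every $t\in[0,1]$, the corresponding flow map $\Phi_t\colon\mathbb{R}^d\to\mathbb{R}^d$ satisfies $(\Phi_t)_{\#}\mathbb{P}_{\mathrm{ref}} = \mathbb{P}_t$. In particular, $T=\Phi_1$ is a transport map from $\mathbb{P}_{\mathrm{ref}}$ to $\mathbb{P}_{\mathrm{tar}}$.
   Context: The flow map $\Phi_t$ sends the initial value $x_0$ to the value $x(t)$ at time $t$ of the solution of the ODE started at $x(0)=x_0$; it is understood as defined for $\mathbb{P}_{\mathrm{ref}}$-almost every $x_0$. For a measurable map $T$ and a probability measure $\mathbb{P}_0$, the pushforward is $(T_{\#}\mathbb{P}_0)(B) := \mathbb{P}_0(T^{-1}(B))$ for measurable $B$; $T$ is called a transport map from $\mathbb{P}_0$ to $\mathbb{P}_1$ if $T_{\#}\mathbb{P}_0=\mathbb{P}_1$. $\mathbb{R}^d$ carries its Borel $\sigma$-algebra, and $\mathrm{Id}_d$ is the $d\times d$ identity matrix. *)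

theory Defs
  imports "HOL-Probability.Probability"
begin

text \<open>
  The space \<open>\<real>\<^sup>d\<close> is \<^typ>\<open>real ^ 'n\<close> with \<open>d = CARD('n)\<close>. The indices \<open>j\<close> range over \<open>{1..J}\<close>;
  values of \<open>w\<close>, \<open>a\<close> and \<open>A\<close> at other indices play no role.
\<close>

definition continuously_differentiable ::
    "('a::real_normed_vector \<Rightarrow> 'b::real_normed_vector) \<Rightarrow> bool" where
  "continuously_differentiable f \<longleftrightarrow>
     (\<exists>f' :: 'a \<Rightarrow> 'a \<Rightarrow>\<^sub>L 'b.
        (\<forall>x. (f has_derivative blinfun_apply (f' x)) (at x)) \<and> continuous_on UNIV f')"

definition sym_pos_def :: "real ^ 'n ^ 'n \<Rightarrow> bool" where
  "sym_pos_def A \<longleftrightarrow> transpose A = A \<and> (\<forall>x. x \<noteq> 0 \<longrightarrow> 0 < x \<bullet> (A *v x))"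

definition distribution :: "(real ^ 'n \<Rightarrow> real) \<Rightarrow> (real ^ 'n) measure" where
  "distribution \<rho> = density lborel (\<lambda>x. ennreal (\<rho> x))"

definition transport_map :: "('a \<Rightarrow> 'b) \<Rightarrow> 'a measure \<Rightarrow> 'b measure \<Rightarrow> bool" where
  "transport_map T P Q \<longleftrightarrow> T \<in> P \<rightarrow>\<^sub>M Q \<and> distr P Q T = Q"

definition affine_density ::
    "(real ^ 'n \<Rightarrow> real) \<Rightarrow> real ^ 'n ^ 'n \<Rightarrow> real ^ 'n \<Rightarrow> real ^ 'n \<Rightarrow> real" where
  "affine_density \<rho> A a x = inverse \<bar>det A\<bar> * \<rho> (matrix_inv A *v (x - a))"

definition tar_density ::
    "(real ^ 'n \<Rightarrow> real) \<Rightarrow> nat \<Rightarrow> (nat \<Rightarrow> real) \<Rightarrow> (nat \<Rightarrow> real ^ 'n) \<Rightarrow> (nat \<Rightarrow> real ^ 'n ^ 'n) \<Rightarrow>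
     real ^ 'n \<Rightarrow> real" where
  "tar_density \<rho> J w a A x = (\<Sum>j = 1..J. w j * affine_density \<rho> (A j) (a j) x)"

definition interp_matrix :: "real ^ 'n ^ 'n \<Rightarrow> real \<Rightarrow> real ^ 'n ^ 'n" where
  "interp_matrix A t = t *\<^sub>R A + (1 - t) *\<^sub>R mat 1"

definition component_density ::
    "(real ^ 'n \<Rightarrow> real) \<Rightarrow> real ^ 'n ^ 'n \<Rightarrow> real ^ 'n \<Rightarrow> real \<Rightarrow> real ^ 'n \<Rightarrow> real" where
  "component_density \<rho> A a t = affine_density \<rho> (interp_matrix A t) (t *\<^sub>R a)"

definition component_velocity ::
    "real ^ 'n ^ 'n \<Rightarrow> real ^ 'n \<Rightarrow> real \<Rightarrow> real ^ 'n \<Rightarrow> real ^ 'n" where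
  "component_velocity A a t x =
     a + ((A - mat 1) ** matrix_inv (interp_matrix A t)) *v (x - t *\<^sub>R a)"

definition mixture_density ::
    "(real ^ 'n \<Rightarrow> real) \<Rightarrow> nat \<Rightarrow> (nat \<Rightarrow> real) \<Rightarrow> (nat \<Rightarrow> real ^ 'n) \<Rightarrow> (nat \<Rightarrow> real ^ 'n ^ 'n) \<Rightarrow>
     real \<Rightarrow> real ^ 'n \<Rightarrow> real" where
  "mixture_density \<rho> J w a A t x = (\<Sum>j = 1..J. w j * component_density \<rho> (A j) (a j) t x)"

definition mixture_velocity ::
    "(real ^ 'n \<Rightarrow> real) \<Rightarrow> nat \<Rightarrow> (nat \<Rightarrow> real) \<Rightarrow> (nat \<Rightarrow> real ^ 'n) \<Rightarrow> (nat \<Rightarrow> real ^ 'n ^ 'n) \<Rightarrow>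
     real \<Rightarrow> real ^ 'n \<Rightarrow> real ^ 'n" where
  "mixture_velocity \<rho> J w a A t x =
     inverse (mixture_density \<rho> J w a A t x) *\<^sub>R
       (\<Sum>j = 1..J. (w j * component_density \<rho> (A j) (a j) t x) *\<^sub>R
                     component_velocity (A j) (a j) t x)"

text \<open>The derivative is one-sided at the endpoints; values of \<open>x\<close> outside \<open>{0..1}\<close> are irrelevant.\<close>

definition ode_solution ::
    "(real \<Rightarrow> 'a::real_normed_vector \<Rightarrow> 'a) \<Rightarrow> 'a \<Rightarrow> (real \<Rightarrow> 'a) \<Rightarrow> bool" where
  "ode_solution v x0 x \<longleftrightarrow>
     x 0 = x0 \<and> (\<forall>t\<in>{0..1}. (x has_vector_derivative v t (x t)) (at t within {0..1}))"

text \<open>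
  The value at time \<open>t\<close> of the solution started at \<open>x0\<close>. It is meaningful only if a solution on
  \<open>{0..1}\<close> exists and is unique there. All \<open>x0\<close> without a solution on \<open>{0..1}\<close> are sent to one and
  the same unspecified point, so they do not affect the measurability of the flow map.
\<close>

definition flow_map :: "(real \<Rightarrow> 'a::real_normed_vector \<Rightarrow> 'a) \<Rightarrow> real \<Rightarrow> 'a \<Rightarrow> 'a" where
  "flow_map v t x0 = (THE y. \<exists>x. ode_solution v x0 x \<and> x t = y)"

end

theory Submission
  imports Defs
begin

text \<open>
  Each component is transported by the straight-line motion \<open>x \<mapsto> A\<^sub>j\<^sub>,\<^sub>t x + t a\<^sub>j\<close>, whose velocity field is
  \<open>v\<^sub>j\<^sub>,\<^sub>t\<close>. Since \<open>v\<^sub>t\<close> is a convex combination of the fields \<open>v\<^sub>j\<^sub>,\<^sub>t\<close>, which are affine in \<open>x\<close> with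
  coefficients bounded in \<open>t\<close>, it grows at most linearly. So its flow \<open>X\<close> is globally defined for every initial value.

  For a \<open>C\<^sup>1\<close> test function \<open>\<psi>\<close> with compact support and a fixed time \<open>T\<close>, the function
  \<open>F s = \<integral> \<psi> (X\<^sub>s\<^sub>,\<^sub>T y) dP\<^sub>s y\<close> is constant on \<open>[0, T]\<close>, which for \<open>s = 0\<close> and \<open>s = T\<close> is the claim. Indeed, with
  the posterior weights \<open>p\<^sub>j = w\<^sub>j \<rho>\<^sub>j\<^sub>,\<^sub>s / \<rho>\<^sub>s\<close>, the increment \<open>F (s + h) - F s\<close> is the \<open>P\<^sub>s\<close>-integral of
  \<open>\<Sum>\<^sub>j p\<^sub>j \<psi> (X (y + h v\<^sub>j\<^sub>,\<^sub>s y)) - \<psi> (X (X\<^sub>s\<^sub>,\<^sub>s\<^sub>+\<^sub>h y))\<close>, where the outer \<open>X\<close> is the flow from \<open>s + h\<close> to \<open>T\<close>. The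
  weighted mean of the points \<open>y + h v\<^sub>j\<^sub>,\<^sub>s y\<close> agrees with \<open>X\<^sub>s\<^sub>,\<^sub>s\<^sub>+\<^sub>h y\<close> up to \<open>o(h)\<close>, and a Gronwall argument
  shows that the flow respects convex combinations of points at mutual distance \<open>O(h)\<close> up to \<open>o(h)\<close>. This
  avoids the differentiability of the flow in the initial value.
\<close>

section \<open>Fields that are continuously differentiable in space\<close>

text \<open>Joint continuity of the spatial derivative in time and space makes all constants uniform
  in \<open>t\<close> on compact sets. The space variable ranges over everything, time only over
  \<open>{0..1}\<close>. A time-independent test function \<open>\<psi>\<close> enters as the
  constant family \<open>\<lambda>_. \<psi>\<close>.\<close>

definition cont_diff_in_space ::
    "(real \<Rightarrow> 'a::real_normed_vector \<Rightarrow> 'b::real_normed_vector) \<Rightarrow> bool" where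
  "cont_diff_in_space f \<longleftrightarrow>
     continuous_on ({0..1} \<times> UNIV) (\<lambda>(t, x). f t x) \<and>
     (\<exists>f' :: real \<Rightarrow> 'a \<Rightarrow> 'a \<Rightarrow>\<^sub>L 'b.
        (\<forall>t\<in>{0..1}. \<forall>x. (f t has_derivative blinfun_apply (f' t x)) (at x)) \<and>
        continuous_on ({0..1} \<times> UNIV) (\<lambda>(t, x). f' t x))"

text \<open>On the compact set of times and points of norm at most \<open>R\<close> the derivative
  is bounded by some \<open>L\<close> and uniformly continuous. Linearising at \<open>z\<close>
  leaves an error \<open>\<epsilon> * d\<close> per point, and the linear part commutes with the
  weighted mean, so that to first order only the displacement of the barycentre counts.
  \<open>L\<close> does not depend on \<open>\<epsilon>\<close>, and \<open>\<delta>\<close> is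
  uniform in the time, the points and the weights.\<close>

lemma cont_diff_in_space_approx_affine:
  fixes f :: "real \<Rightarrow> 'a::euclidean_space \<Rightarrow> 'b::real_normed_vector"
  assumes "cont_diff_in_space f"
  obtains L where "L \<ge> 0"
    and "\<And>t x y. t \<in> {0..1} \<Longrightarrow> norm x \<le> R \<Longrightarrow> norm y \<le> R \<Longrightarrow> norm (f t x - f t y) \<le> L * norm (x - y)"
    and "\<And>\<epsilon>. \<epsilon> > 0 \<Longrightarrow> \<exists>\<delta>>0. \<forall>t\<in>{0..1}. \<forall>z d. \<forall>I::'i set. \<forall>p y. norm z \<le> R \<longrightarrow> d < \<delta> \<longrightarrow>
      (\<forall>i\<in>I. 0 \<le> p i \<and> norm (y i) \<le> R \<and> norm (y i - z) \<le> d) \<longrightarrow> sum p I = 1 \<longrightarrow>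
      norm ((\<Sum>i\<in>I. p i *\<^sub>R f t (y i)) - f t z) \<le> L * norm ((\<Sum>i\<in>I. p i *\<^sub>R y i) - z) + \<epsilon> * d"
proof -
  obtain f' :: "real \<Rightarrow> 'a \<Rightarrow> 'a \<Rightarrow>\<^sub>L 'b"
    where der: "\<And>t x. t \<in> {0..1} \<Longrightarrow> (f t has_derivative blinfun_apply (f' t x)) (at x)"
      and cont: "continuous_on ({0..1} \<times> UNIV) (\<lambda>(t, x). f' t x)"
    using assms unfolding cont_diff_in_space_def by blast
  define K where "K = {0..1::real} \<times> cball (0::'a) R"
  have K: "compact K" unfolding K_def by (intro compact_Times compact_cball) simp
  have contK: "continuous_on K (\<lambda>(t, x). f' t x)"
    by (rule continuous_on_subset[OF cont]) (auto simp: K_def)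
  have "bounded ((\<lambda>(t, x). f' t x) ` K)"
    by (intro compact_imp_bounded compact_continuous_image contK K)
  then obtain L where L: "L > 0" "\<And>w. w \<in> K \<Longrightarrow> norm (case w of (t, x) \<Rightarrow> f' t x) \<le> L"
    unfolding bounded_pos by blast
  have L': "norm (f' t x) \<le> L" if "t \<in> {0..1}" "norm x \<le> R" for t x
    using L(2)[of "(t, x)"] that by (auto simp: K_def)
  have unif: "uniformly_continuous_on K (\<lambda>(t, x). f' t x)"
    by (rule compact_uniformly_continuous[OF contK K])
  show thesis
  proof
    show "L \<ge> 0" using L by simp
  next
    fix t :: real and x y :: 'a assume t: "t \<in> {0..1}" and xy: "norm x \<le> R" "norm y \<le> R"
    show "norm (f t x - f t y) \<le> L * norm (x - y)"
    proof (rule differentiable_bound[where S = "cball 0 R" and f' = "\<lambda>x. blinfun_apply (f' t x)"])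
      fix x :: 'a assume "x \<in> cball 0 R"
      then show "onorm (blinfun_apply (f' t x)) \<le> L"
        using L'[OF t, of x] by (simp flip: norm_blinfun.rep_eq)
      show "(f t has_derivative blinfun_apply (f' t x)) (at x within cball 0 R)"
        using der[OF t] has_derivative_at_withinI by blast
    qed (use xy in auto)
  next
    fix \<epsilon> :: real assume "\<epsilon> > 0"
    then obtain \<delta> where "\<delta> > 0"
      and \<delta>: "\<And>w w'. w \<in> K \<Longrightarrow> w' \<in> K \<Longrightarrow> dist w' w < \<delta> \<Longrightarrow>
          dist (case w' of (t, x) \<Rightarrow> f' t x) (case w of (t, x) \<Rightarrow> f' t x) < \<epsilon>"
      using unif unfolding uniformly_continuous_on_def by metis
    \<comment> \<open>First-order Taylor estimate: the mean value inequality is applied to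
      \<open>f t\<close> minus its linearisation at \<open>z\<close>. The set \<open>S\<close> below
      is convex, contains both points and keeps every point within \<open>\<delta>\<close> of
      \<open>z\<close>.\<close>
    have lin: "norm (f t y - f t z - f' t z (y - z)) \<le> \<epsilon> * d"
      if "t \<in> {0..1}" "norm z \<le> R" "norm y \<le> R" "norm (y - z) \<le> d" "d < \<delta>" for t z y d
    proof -
      define S where "S = cball (0::'a) R \<inter> cball z d"
      have d: "d \<ge> 0" using that(4) norm_ge_zero order_trans by blast
      have "norm ((f t y - f' t z y) - (f t z - f' t z z)) \<le> \<epsilon> * norm (y - z)"
      proof (rule differentiable_bound[where S = S and f' = "\<lambda>x h. f' t x h - f' t z h"])
        show "convex S" unfolding S_def by (intro convex_Int convex_cball)
        fix x assume x: "x \<in> S"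
        show "((\<lambda>x. f t x - f' t z x) has_derivative (\<lambda>h. f' t x h - f' t z h)) (at x within S)"
          by (auto intro!: derivative_eq_intros has_derivative_at_withinI[OF der] that)
        have "dist (f' t x) (f' t z) < \<epsilon>"
          using \<delta>[of "(t, z)" "(t, x)"] x that by (auto simp: K_def S_def dist_Pair_Pair dist_commute)
        then have "norm (f' t x - f' t z) \<le> \<epsilon>" by (simp add: dist_norm)
        then show "onorm (\<lambda>h. f' t x h - f' t z h) \<le> \<epsilon>"
          by (simp add: norm_blinfun.rep_eq minus_blinfun.rep_eq)
      qed (use that d in \<open>auto simp: S_def dist_norm norm_minus_commute\<close>)
      also have "\<dots> \<le> \<epsilon> * d" using that \<open>\<epsilon> > 0\<close> by (intro mult_left_mono) auto
      finally show ?thesis by (simp add: blinfun.diff_right algebra_simps)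
    qed
    show "\<exists>\<delta>>0. \<forall>t\<in>{0..1}. \<forall>z d. \<forall>I::'i set. \<forall>p y. norm z \<le> R \<longrightarrow> d < \<delta> \<longrightarrow>
      (\<forall>i\<in>I. 0 \<le> p i \<and> norm (y i) \<le> R \<and> norm (y i - z) \<le> d) \<longrightarrow> sum p I = 1 \<longrightarrow>
      norm ((\<Sum>i\<in>I. p i *\<^sub>R f t (y i)) - f t z) \<le> L * norm ((\<Sum>i\<in>I. p i *\<^sub>R y i) - z) + \<epsilon> * d"
    proof (intro exI[of _ \<delta>] conjI ballI allI impI \<open>\<delta> > 0\<close>)
      fix t d :: real and z :: 'a and I :: "'i set" and p :: "'i \<Rightarrow> real" and y :: "'i \<Rightarrow> 'a"
      assume t: "t \<in> {0..1}" and z: "norm z \<le> R" and d: "d < \<delta>" and p: "sum p I = 1"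
        and y: "\<forall>i\<in>I. 0 \<le> p i \<and> norm (y i) \<le> R \<and> norm (y i - z) \<le> d"
      have comb: "(\<Sum>i\<in>I. p i *\<^sub>R (c::'b)) = c" for c
        using p by (simp flip: scaleR_left.sum)
      have "(\<Sum>i\<in>I. p i *\<^sub>R f t (y i)) - f t z - f' t z ((\<Sum>i\<in>I. p i *\<^sub>R y i) - z) =
          (\<Sum>i\<in>I. p i *\<^sub>R (f t (y i) - f t z - f' t z (y i - z)))"
        by (simp add: scaleR_diff_right sum_subtractf comb blinfun.diff_right blinfun.sum_right
            blinfun.scaleR_right)
      also have "norm \<dots> \<le> (\<Sum>i\<in>I. p i * (\<epsilon> * d))"
        using y by (intro sum_norm_le) (auto intro!: mult_left_mono lin t z d)
      also have "\<dots> = \<epsilon> * d" using p by (simp flip: sum_distrib_right)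
      finally have "norm ((\<Sum>i\<in>I. p i *\<^sub>R f t (y i)) - f t z - f' t z ((\<Sum>i\<in>I. p i *\<^sub>R y i) - z)) \<le> \<epsilon> * d" .
      moreover have "norm (f' t z ((\<Sum>i\<in>I. p i *\<^sub>R y i) - z)) \<le> L * norm ((\<Sum>i\<in>I. p i *\<^sub>R y i) - z)"
        by (rule order_trans[OF norm_blinfun]) (intro mult_right_mono L' t z norm_ge_zero)
      ultimately show "norm ((\<Sum>i\<in>I. p i *\<^sub>R f t (y i)) - f t z) \<le>
          L * norm ((\<Sum>i\<in>I. p i *\<^sub>R y i) - z) + \<epsilon> * d"
        using norm_triangle_sub[of "(\<Sum>i\<in>I. p i *\<^sub>R f t (y i)) - f t z"
            "f' t z ((\<Sum>i\<in>I. p i *\<^sub>R y i) - z)"] by linarith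
    qed
  qed
qed

lemma cont_diff_in_space_lipschitz:
  fixes f :: "real \<Rightarrow> 'a::euclidean_space \<Rightarrow> 'b::real_normed_vector"
  assumes "cont_diff_in_space f"
  obtains L where "L \<ge> 0"
    and "\<And>t x y. t \<in> {0..1} \<Longrightarrow> norm x \<le> R \<Longrightarrow> norm y \<le> R \<Longrightarrow> norm (f t x - f t y) \<le> L * norm (x - y)"
  \<comment> \<open>The index type occurs only in the discarded third fact and has to be fixed by
    hand.\<close>
  by (rule cont_diff_in_space_approx_affine[OF assms, where R = R and 'i = nat]) (rule that)

section \<open>Closure of the class under composition and algebraic operations\<close>

lemma cont_diff_in_spaceI:
  assumes "continuous_on ({0..1} \<times> UNIV) (\<lambda>(t, x). f t x)"
    and "\<And>t x. t \<in> {0..1} \<Longrightarrow> (f t has_derivative blinfun_apply (f' t x)) (at x)"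
    and "continuous_on ({0..1} \<times> UNIV) (\<lambda>(t, x). f' t x)"
  shows "cont_diff_in_space f"
  using assms unfolding cont_diff_in_space_def by blast

lemma cont_diff_in_spaceE:
  assumes "cont_diff_in_space f"
  obtains f' where "continuous_on ({0..1} \<times> UNIV) (\<lambda>w. f (fst w) (snd w))"
    and "\<And>t x. t \<in> {0..1} \<Longrightarrow> (f t has_derivative blinfun_apply (f' t x)) (at x)"
    and "continuous_on ({0..1} \<times> UNIV) (\<lambda>w. f' (fst w) (snd w))"
  using assms unfolding cont_diff_in_space_def case_prod_unfold by blast

lemma continuous_on_fst_time:
  assumes "continuous_on {0..1::real} c"
  shows "continuous_on ({0..1} \<times> UNIV) (\<lambda>w. c (fst w))"
  by (rule continuous_on_compose2[OF assms]) (auto intro!: continuous_intros)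

lemma cont_diff_in_space_affine:
  fixes B :: "real \<Rightarrow> 'a::real_normed_vector \<Rightarrow>\<^sub>L 'b::real_normed_vector"
  assumes B: "continuous_on {0..1} B" and c: "continuous_on {0..1} c"
  shows "cont_diff_in_space (\<lambda>t x. blinfun_apply (B t) x + c t)"
proof (rule cont_diff_in_spaceI[where f' = "\<lambda>t x. B t"])
  show "((\<lambda>x. blinfun_apply (B t) x + c t) has_derivative blinfun_apply (B t)) (at x)" for t x
    by (auto intro!: derivative_eq_intros)
qed (auto simp: case_prod_unfold intro!: continuous_intros continuous_on_fst_time[OF B] continuous_on_fst_time[OF c])

lemma cont_diff_in_space_compose:
  assumes f: "continuously_differentiable f" and h: "cont_diff_in_space h"
  shows "cont_diff_in_space (\<lambda>t x. f (h t x))"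
proof -
  obtain f' where f': "\<And>x. (f has_derivative blinfun_apply (f' x)) (at x)" "continuous_on UNIV f'"
    using f unfolding continuously_differentiable_def by blast
  have f_cont: "continuous_on UNIV f"
    using f'(1) by (meson continuous_at_imp_continuous_on has_derivative_continuous)
  obtain h' where h': "continuous_on ({0..1} \<times> UNIV) (\<lambda>w. h (fst w) (snd w))"
    "\<And>t x. t \<in> {0..1} \<Longrightarrow> (h t has_derivative blinfun_apply (h' t x)) (at x)"
    "continuous_on ({0..1} \<times> UNIV) (\<lambda>w. h' (fst w) (snd w))"
    by (rule cont_diff_in_spaceE[OF h]) (rule that)
  show ?thesis
  proof (rule cont_diff_in_spaceI[where f' = "\<lambda>t x. f' (h t x) o\<^sub>L h' t x"])
    fix t :: real and x assume "t \<in> {0..1}"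
    then show "((\<lambda>x. f (h t x)) has_derivative blinfun_apply (f' (h t x) o\<^sub>L h' t x)) (at x)"
      using has_derivative_compose[OF h'(2) f'(1)] by (simp add: blinfun_compose.rep_eq o_def)
  qed (auto simp: case_prod_unfold intro!: continuous_intros h' continuous_on_compose2[OF f_cont]
      continuous_on_compose2[OF f'(2)])
qed

lemma cont_diff_in_space_scaleR:
  fixes f :: "real \<Rightarrow> 'a::real_normed_vector \<Rightarrow> real" and g :: "real \<Rightarrow> 'a \<Rightarrow> 'b::real_normed_vector"
  assumes f: "cont_diff_in_space f" and g: "cont_diff_in_space g"
  shows "cont_diff_in_space (\<lambda>t x. f t x *\<^sub>R g t x)"
proof -
  obtain f' where f': "continuous_on ({0..1} \<times> UNIV) (\<lambda>w. f (fst w) (snd w))"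
    "\<And>t x. t \<in> {0..1} \<Longrightarrow> (f t has_derivative blinfun_apply (f' t x)) (at x)"
    "continuous_on ({0..1} \<times> UNIV) (\<lambda>w. f' (fst w) (snd w))"
    by (rule cont_diff_in_spaceE[OF f]) (rule that)
  obtain g' where g': "continuous_on ({0..1} \<times> UNIV) (\<lambda>w. g (fst w) (snd w))"
    "\<And>t x. t \<in> {0..1} \<Longrightarrow> (g t has_derivative blinfun_apply (g' t x)) (at x)"
    "continuous_on ({0..1} \<times> UNIV) (\<lambda>w. g' (fst w) (snd w))"
    by (rule cont_diff_in_spaceE[OF g]) (rule that)
  show ?thesis
  \<comment> \<open>Product rule; the second summand is the rank-one map sending a direction
    \<open>h\<close> to \<open>f' t x h\<close> times the vector \<open>g t x\<close>.\<close>
  proof (rule cont_diff_in_spaceI[where f' = "\<lambda>t x. f t x *\<^sub>R g' t x + (blinfun_scaleR_left (g t x) o\<^sub>L f' t x)"])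
    fix t :: real and x assume "t \<in> {0..1}"
    then show "((\<lambda>x. f t x *\<^sub>R g t x) has_derivative
        blinfun_apply (f t x *\<^sub>R g' t x + (blinfun_scaleR_left (g t x) o\<^sub>L f' t x))) (at x)"
      using has_derivative_scaleR[OF f'(2) g'(2)]
      by (simp add: plus_blinfun.rep_eq scaleR_blinfun.rep_eq)
  qed (auto simp: case_prod_unfold intro!: continuous_intros f' g'
      bounded_linear.continuous_on[OF bounded_linear_blinfun_scaleR_left])
qed

lemma cont_diff_in_space_add:
  assumes f: "cont_diff_in_space f" and g: "cont_diff_in_space g"
  shows "cont_diff_in_space (\<lambda>t x. f t x + g t x)"
proof -
  obtain f' where f': "continuous_on ({0..1} \<times> UNIV) (\<lambda>w. f (fst w) (snd w))"
    "\<And>t x. t \<in> {0..1} \<Longrightarrow> (f t has_derivative blinfun_apply (f' t x)) (at x)"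
    "continuous_on ({0..1} \<times> UNIV) (\<lambda>w. f' (fst w) (snd w))"
    by (rule cont_diff_in_spaceE[OF f]) (rule that)
  obtain g' where g': "continuous_on ({0..1} \<times> UNIV) (\<lambda>w. g (fst w) (snd w))"
    "\<And>t x. t \<in> {0..1} \<Longrightarrow> (g t has_derivative blinfun_apply (g' t x)) (at x)"
    "continuous_on ({0..1} \<times> UNIV) (\<lambda>w. g' (fst w) (snd w))"
    by (rule cont_diff_in_spaceE[OF g]) (rule that)
  show ?thesis
  proof (rule cont_diff_in_spaceI[where f' = "\<lambda>t x. f' t x + g' t x"])
    fix t :: real and x assume "t \<in> {0..1}"
    then show "((\<lambda>x. f t x + g t x) has_derivative blinfun_apply (f' t x + g' t x)) (at x)"
      using has_derivative_add[OF f'(2) g'(2)] by (simp add: plus_blinfun.rep_eq)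
  qed (auto simp: case_prod_unfold intro!: continuous_intros f' g')
qed

lemma cont_diff_in_space_time:
  assumes "continuous_on {0..1} c"
  shows "cont_diff_in_space (\<lambda>t x. c t)"
  using cont_diff_in_space_affine[of "\<lambda>_. 0" c] assms by simp

lemma cont_diff_in_space_sum:
  assumes "\<And>i. i \<in> I \<Longrightarrow> cont_diff_in_space (f i)"
  shows "cont_diff_in_space (\<lambda>t x. \<Sum>i\<in>I. f i t x)"
  using assms
  by (induction I rule: infinite_finite_induct)
    (auto intro!: cont_diff_in_space_add cont_diff_in_space_time)

lemma cont_diff_in_space_prod:
  fixes f :: "'i \<Rightarrow> real \<Rightarrow> 'a::real_normed_vector \<Rightarrow> real"
  assumes "\<And>i. i \<in> I \<Longrightarrow> cont_diff_in_space (f i)"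
  shows "cont_diff_in_space (\<lambda>t x. \<Prod>i\<in>I. f i t x)"
  using assms
  by (induction I rule: infinite_finite_induct)
    \<comment> \<open>Real multiplication is \<open>scaleR\<close> at type \<open>real\<close>, so
      the product rule for fields covers products of scalars.\<close>
    (auto intro!: cont_diff_in_space_scaleR[where 'b = real, unfolded real_scaleR_def] cont_diff_in_space_time)

lemma cont_diff_in_space_inverse:
  fixes f :: "real \<Rightarrow> 'a::real_normed_vector \<Rightarrow> real"
  assumes f: "cont_diff_in_space f" and nz: "\<And>t x. t \<in> {0..1} \<Longrightarrow> f t x \<noteq> 0"
  shows "cont_diff_in_space (\<lambda>t x. inverse (f t x))"
proof -
  obtain f' where f': "continuous_on ({0..1} \<times> UNIV) (\<lambda>w. f (fst w) (snd w))"
    "\<And>t x. t \<in> {0..1} \<Longrightarrow> (f t has_derivative blinfun_apply (f' t x)) (at x)"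
    "continuous_on ({0..1} \<times> UNIV) (\<lambda>w. f' (fst w) (snd w))"
    by (rule cont_diff_in_spaceE[OF f]) (rule that)
  show ?thesis
  proof (rule cont_diff_in_spaceI[where f' = "\<lambda>t x. - (inverse (f t x))\<^sup>2 *\<^sub>R f' t x"])
    fix t :: real and x assume "t \<in> {0..1}"
    then show "((\<lambda>x. inverse (f t x)) has_derivative blinfun_apply (- (inverse (f t x))\<^sup>2 *\<^sub>R f' t x)) (at x)"
      using Deriv.has_derivative_inverse[OF nz f'(2)]
      by (simp add: scaleR_blinfun.rep_eq uminus_blinfun.rep_eq power2_eq_square mult_ac)
  qed (use nz in \<open>auto simp: case_prod_unfold intro!: continuous_intros f'\<close>)
qed

section \<open>Determination of measures by test functions\<close>

text \<open>Building block for compactly supported \<open>C\<^sup>1\<close> functions: squaring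
  removes the kink of the positive part, because the difference quotient at 0 is at most
  \<open>\<bar>h\<bar>\<close>.\<close>

lemma continuously_differentiable_max0_square:
  "continuously_differentiable (\<lambda>s::real. (max 0 s)\<^sup>2)"
  unfolding continuously_differentiable_def
proof (intro exI[of _ "\<lambda>s. blinfun_mult_right (2 * max 0 s)"] conjI allI)
  fix s :: real
  have "((\<lambda>s::real. (max 0 s)\<^sup>2) has_real_derivative 2 * max 0 s) (at s)"
  proof (cases "s = 0")
    case True
    have "((\<lambda>h::real. (max 0 h)\<^sup>2 / h) \<longlongrightarrow> 0) (at 0)"
    proof (rule tendsto_0_le[where K = 1])
      show "((\<lambda>h::real. h) \<longlongrightarrow> 0) (at 0)" by (rule tendsto_ident_at)
      show "\<forall>\<^sub>F h::real in at 0. norm ((max 0 h)\<^sup>2 / h) \<le> norm h * (1::real)"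
        by (intro always_eventually allI) (auto simp: max_def power2_eq_square)
    qed
    with True show ?thesis by (simp add: DERIV_def)
  next
    case False
    then consider "s < 0" | "s > 0" by linarith
    then show ?thesis
    proof cases
      case 1
      have "((\<lambda>s::real. 0) has_real_derivative 2 * max 0 s) (at s)" using 1 by simp
      then show ?thesis
        by (rule DERIV_cong_ev[OF refl _ refl, THEN iffD1, rotated])
          (use eventually_nhds_in_open[of "{..<0}" s] 1 in \<open>auto elim!: eventually_mono\<close>)
    next
      case 2
      have "((\<lambda>s::real. s\<^sup>2) has_real_derivative 2 * max 0 s) (at s)"
        using 2 by (auto intro!: derivative_eq_intros)
      then show ?thesis
        by (rule DERIV_cong_ev[OF refl _ refl, THEN iffD1, rotated])
          (use eventually_nhds_in_open[of "{0<..}" s] 2 in \<open>auto elim!: eventually_mono\<close>)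
    qed
  qed
  then show "((\<lambda>s::real. (max 0 s)\<^sup>2) has_derivative blinfun_mult_right (2 * max 0 s)) (at s)"
    by (simp add: has_field_derivative_def)
qed (auto intro!: continuous_intros bounded_linear.continuous_on[OF bounded_linear_blinfun_mult_right])

text \<open>Open boxes form an intersection-stable generator of the Borel sets, and the indicator of
  a box is a pointwise limit of admissible test functions, so dominated convergence transfers the
  equality of integrals to boxes. The restrictions on \<open>\<psi>\<close> are those under which
  \<open>integral_flow\<close> is available.\<close>

lemma borel_measure_eq_by_test_functions:
  fixes M N :: "'a::euclidean_space measure"
  assumes M: "prob_space M" "sets M = sets borel" and N: "prob_space N" "sets N = sets borel"
    and eq: "\<And>\<psi> R. cont_diff_in_space (\<lambda>_. \<psi>) \<Longrightarrow> 0 \<le> R \<Longrightarrow> (\<And>x. norm x > R \<Longrightarrow> \<psi> x = 0) \<Longrightarrow>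
      (\<And>x. 0 \<le> \<psi> x \<and> \<psi> x \<le> (1::real)) \<Longrightarrow> (\<integral>x. \<psi> x \<partial>M) = (\<integral>x. \<psi> x \<partial>N)"
  shows "M = N"
proof (rule measure_eqI_generator_eq[where \<Omega> = UNIV and A = "\<lambda>n. box (- real n *\<^sub>R One) (real n *\<^sub>R One)"])
  interpret M: prob_space M by fact
  interpret N: prob_space N by fact
  have space: "space M = UNIV" "space N = UNIV"
    using M(2) N(2) by (auto dest: sets_eq_imp_space_eq)
  show "Int_stable (range (\<lambda>(a, b). box a b :: 'a set))"
    by (auto simp: Int_stable_def box_Int_box)
  show "sets M = sigma_sets UNIV (range (\<lambda>(a, b). box a b))"
    "sets N = sigma_sets UNIV (range (\<lambda>(a, b). box a b))"
    using M(2) N(2) by (simp_all add: borel_eq_box)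
  show "emeasure M (box (- real i *\<^sub>R One) (real i *\<^sub>R One)) \<noteq> \<infinity>" for i
    by simp
  show "(\<Union>i. box (- real i *\<^sub>R One) (real i *\<^sub>R One)) = (UNIV::'a set)"
    by (simp add: UN_box_eq_UNIV)
  fix X :: "'a set" assume "X \<in> range (\<lambda>(a, b). box a b)"
  then obtain a b where X: "X = box a b" by auto
  \<comment> \<open>\<open>q\<close> is \<open>C\<^sup>1\<close> and positive exactly on the open
    box. Hence \<open>\<psi> n = q / (1 / (n + 1) + q)\<close> vanishes off the box and tends to 1
    on it, and its denominator is positive everywhere.\<close>
  define q where "q x = (\<Prod>i\<in>Basis. (max 0 (x \<bullet> i - a \<bullet> i))\<^sup>2 * (max 0 (b \<bullet> i - x \<bullet> i))\<^sup>2)" for x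
  define \<psi> where "\<psi> n x = q x * inverse (inverse (real (Suc n)) + q x)" for n x
  have q0: "q x \<ge> 0" for x unfolding q_def by (intro prod_nonneg) auto
  have q_pos: "q x > 0 \<longleftrightarrow> x \<in> X" for x
  proof
    assume "x \<in> X"
    then show "q x > 0" unfolding q_def X by (intro prod_pos) (auto simp: mem_box)
  next
    assume "q x > 0"
    show "x \<in> X"
    proof (rule ccontr)
      assume "x \<notin> X"
      then obtain i where "i \<in> Basis" "\<not> (a \<bullet> i < x \<bullet> i \<and> x \<bullet> i < b \<bullet> i)"
        by (auto simp: X mem_box)
      then have "q x = 0"
        unfolding q_def by (intro prod_zero bexI[of _ i]) auto
      with \<open>q x > 0\<close> show False by simp
    qed
  qed
  have den: "inverse (real (Suc n)) + q x > 0" for n x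
    using q0[of x] by (intro add_pos_nonneg) auto
  have lin: "cont_diff_in_space (\<lambda>_ x. blinfun_inner_left i x + c)" for i :: 'a and c
    by (rule cont_diff_in_space_affine) auto
  have lin': "cont_diff_in_space (\<lambda>_ x. (- blinfun_inner_left i) x + c)" for i :: 'a and c
    by (rule cont_diff_in_space_affine) auto
  have q_cd: "cont_diff_in_space (\<lambda>_. q)"
    unfolding q_def
    by (intro cont_diff_in_space_prod cont_diff_in_space_scaleR[where 'b = real, unfolded real_scaleR_def]
        cont_diff_in_space_compose[OF continuously_differentiable_max0_square])
      (use lin[of _ "- (a \<bullet> _)"] lin'[of _ "b \<bullet> _"] in \<open>simp_all add: uminus_blinfun.rep_eq\<close>)
  have \<psi>_cd: "cont_diff_in_space (\<lambda>_. \<psi> n)" for n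
    unfolding \<psi>_def
    by (intro cont_diff_in_space_scaleR[where 'b = real, unfolded real_scaleR_def] q_cd
        cont_diff_in_space_inverse cont_diff_in_space_add cont_diff_in_space_time)
      (use den in \<open>auto simp: less_imp_neq[symmetric]\<close>)
  have \<psi>_range: "0 \<le> \<psi> n x \<and> \<psi> n x \<le> 1" for n x
    using q0[of x] den[of n x] by (auto simp: \<psi>_def field_simps)
  obtain R where R: "R \<ge> 0" "\<And>x. x \<in> X \<Longrightarrow> norm x \<le> R"
    using bounded_box[of a b] unfolding X bounded_pos by (meson less_imp_le)
  have \<psi>_supp: "\<psi> n x = 0" if "norm x > R" for n x
  proof -
    have "x \<notin> X" using R(2)[of x] that by force
    then show ?thesis using q_pos[of x] q0[of x] by (simp add: \<psi>_def)
  qed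
  have \<psi>_lim: "(\<lambda>n. \<psi> n x) \<longlonglongrightarrow> indicator X x" for x
  proof (cases "x \<in> X")
    case True
    then have "q x \<noteq> 0" using q_pos[of x] by auto
    then have "(\<lambda>n. q x * inverse (inverse (real (Suc n)) + q x)) \<longlonglongrightarrow> q x * inverse (0 + q x)"
      by (intro tendsto_intros LIMSEQ_inverse_real_of_nat) auto
    with True \<open>q x \<noteq> 0\<close> show ?thesis by (simp add: \<psi>_def)
  next
    case False
    then show ?thesis using q_pos[of x] q0[of x] by (simp add: \<psi>_def)
  qed
  have lim: "(\<lambda>n. \<integral>x. \<psi> n x \<partial>P) \<longlonglongrightarrow> measure P X"
    if P: "prob_space P" "sets P = sets borel" for P :: "'a measure"
  proof -
    interpret P: prob_space P by fact
    have meas: "borel_measurable P = borel_measurable borel"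
      using P(2) by (rule measurable_cong_sets) simp
    have X_sets: "X \<in> sets P" by (simp add: P(2) X)
    have q_meas: "q \<in> borel_measurable borel"
      unfolding q_def by measurable
    have "(\<lambda>n. \<integral>x. \<psi> n x \<partial>P) \<longlonglongrightarrow> (\<integral>x. indicator X x \<partial>P)"
    proof (rule integral_dominated_convergence[where w = "\<lambda>_. 1"])
      show "\<psi> n \<in> borel_measurable P" for n
        unfolding meas \<psi>_def using q_meas by measurable
      show "(indicator X :: 'a \<Rightarrow> real) \<in> borel_measurable P" using X_sets by simp
    qed (use \<psi>_lim \<psi>_range in auto)
    then show ?thesis using X_sets by (simp add: sets.Int_space_eq2)
  qed
  have "(\<integral>x. \<psi> n x \<partial>M) = (\<integral>x. \<psi> n x \<partial>N)" for n
    by (rule eq[OF \<psi>_cd R(1) \<psi>_supp \<psi>_range])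
  then have "measure M X = measure N X"
    using lim[OF M] lim[OF N] by (simp add: LIMSEQ_unique)
  then show "emeasure M X = emeasure N X"
    by (simp add: M.emeasure_eq_measure N.emeasure_eq_measure)
qed auto

section \<open>Gronwall's inequality and the Picard-Lindeloef theorem\<close>

text \<open>The function \<open>exp (- L * (r - a)) * norm (f r) - c * (r - a)\<close> is
  decreasing. The bound contains no division by \<open>L\<close>, so it also covers
  \<open>L = 0\<close>, where it is the mean value inequality.\<close>

lemma gronwall:
  fixes f :: "real \<Rightarrow> 'a::real_inner"
  assumes "a \<le> b" "0 \<le> L" "0 \<le> c"
    and der: "\<And>r. r \<in> {a..b} \<Longrightarrow> (f has_vector_derivative f' r) (at r within {a..b})"
    and bound: "\<And>r. r \<in> {a..b} \<Longrightarrow> norm (f' r) \<le> L * norm (f r) + c"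
  shows "norm (f b) \<le> exp (L * (b - a)) * (norm (f a) + c * (b - a))"
proof -
  have cont: "continuous_on {a..b} f"
    using der by (meson continuous_on_eq_continuous_within has_vector_derivative_continuous)
  have reg: "norm (f b) \<le> exp (L * (b - a)) * (norm (f a) + \<eta> + c * (b - a))" if "\<eta> > 0" for \<eta>
  proof -
    \<comment> \<open>regularised norm: differentiable also where \<open>f\<close> vanishes\<close>
    define u where "u r = sqrt (f r \<bullet> f r + \<eta>\<^sup>2)" for r
    define g where "g r = exp (- L * (r - a)) * u r - c * (r - a)" for r
    have pos: "f r \<bullet> f r + \<eta>\<^sup>2 > 0" for r
      using that by (simp add: add_nonneg_pos)
    have u_pos: "u r > 0" and u_ge: "norm (f r) \<le> u r" for r
      using pos[of r] by (auto simp: u_def norm_eq_sqrt_inner)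
    have "g b \<le> g a"
    proof (rule DERIV_nonpos_imp_decreasing_open[OF \<open>a \<le> b\<close>])
      show "continuous_on {a..b} g"
        unfolding g_def u_def by (intro continuous_intros cont)
      fix r assume r: "a < r" "r < b"
      then have "(f has_vector_derivative f' r) (at r)"
        using der[of r] by (metis atLeastAtMost_iff at_within_Icc_at less_imp_le)
      then have "(f has_derivative (\<lambda>h. h *\<^sub>R f' r)) (at r)"
        by (simp add: has_vector_derivative_def)
      then have "((\<lambda>r. f r \<bullet> f r + \<eta>\<^sup>2) has_derivative (\<lambda>h. h * (2 * (f r \<bullet> f' r)))) (at r)"
        by (auto intro!: derivative_eq_intros simp: inner_commute algebra_simps)
      then have "((\<lambda>r. f r \<bullet> f r + \<eta>\<^sup>2) has_real_derivative 2 * (f r \<bullet> f' r)) (at r)"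
        by (simp add: has_field_derivative_def mult_commute_abs)
      from DERIV_real_sqrt[THEN DERIV_chain2, OF pos this]
      have u': "(u has_real_derivative (f r \<bullet> f' r) / u r) (at r)"
        unfolding u_def by (simp add: field_simps)
      have "(f r \<bullet> f' r) / u r \<le> L * u r + c"
      proof -
        have "f r \<bullet> f' r \<le> norm (f r) * norm (f' r)"
          by (rule norm_cauchy_schwarz)
        also have "\<dots> \<le> u r * (L * u r + c)"
          using bound[of r] r u_ge[of r] u_pos[of r] \<open>0 \<le> L\<close>
          by (intro mult_mono order_trans[OF bound[of r]] add_right_mono mult_left_mono) auto
        finally show ?thesis using u_pos[of r] by (simp add: field_simps)
      qed
      then have "exp (- L * (r - a)) * ((f r \<bullet> f' r) / u r - L * u r) \<le> exp (- L * (r - a)) * c"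
        by (intro mult_left_mono) auto
      also have "\<dots> \<le> 1 * c"
        using r \<open>0 \<le> L\<close> \<open>0 \<le> c\<close> by (intro mult_right_mono) auto
      finally have "exp (- L * (r - a)) * ((f r \<bullet> f' r) / u r - L * u r) \<le> 1 * c" .
      moreover have "(g has_real_derivative exp (- L * (r - a)) * ((f r \<bullet> f' r) / u r - L * u r) - c) (at r)"
        unfolding g_def by (auto intro!: derivative_eq_intros u' simp: algebra_simps)
      ultimately show "\<exists>y. DERIV g r :> y \<and> y \<le> 0" by auto
    qed
    then have "exp (- L * (b - a)) * u b \<le> u a + c * (b - a)"
      by (simp add: g_def)
    then have "exp (L * (b - a)) * (exp (- L * (b - a)) * u b) \<le> exp (L * (b - a)) * (u a + c * (b - a))"
      by (rule mult_left_mono) simp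
    then have "u b \<le> exp (L * (b - a)) * (u a + c * (b - a))"
      by (simp flip: mult.assoc exp_add)
    also have "u a \<le> norm (f a) + \<eta>"
      unfolding u_def using that
      by (intro real_le_lsqrt) (auto simp: power2_sum power2_norm_eq_inner)
    finally show ?thesis using u_ge[of b] by (simp add: algebra_simps)
  qed
  \<comment> \<open>The regularisation is removed by letting \<open>\<eta>\<close> tend to 0 from
    the right.\<close>
  have "((\<lambda>\<eta>. exp (L * (b - a)) * (norm (f a) + \<eta> + c * (b - a))) \<longlongrightarrow>
      exp (L * (b - a)) * (norm (f a) + 0 + c * (b - a))) (at_right 0)"
    by (intro tendsto_intros)
  moreover have "eventually (\<lambda>\<eta>. norm (f b) \<le> exp (L * (b - a)) * (norm (f a) + \<eta> + c * (b - a))) (at_right 0)"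
    using reg by (auto simp: eventually_at_right_field intro: exI[of _ 1])
  ultimately show ?thesis
    using tendsto_lowerbound trivial_limit_at_right_real by fastforce
qed

text \<open>Reflecting time by \<open>r \<mapsto> a + b - r\<close> exchanges the endpoints and only
  flips the sign of the derivative, which the bound on its norm does not see.\<close>

lemma gronwall_backward:
  fixes f :: "real \<Rightarrow> 'a::real_inner"
  assumes "a \<le> b" "0 \<le> L" "0 \<le> c"
    and der: "\<And>r. r \<in> {a..b} \<Longrightarrow> (f has_vector_derivative f' r) (at r within {a..b})"
    and bound: "\<And>r. r \<in> {a..b} \<Longrightarrow> norm (f' r) \<le> L * norm (f r) + c"
  shows "norm (f a) \<le> exp (L * (b - a)) * (norm (f b) + c * (b - a))"
proof -
  have "norm (f (a + b - b)) \<le> exp (L * (b - a)) * (norm (f (a + b - a)) + c * (b - a))"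
  proof (rule gronwall[where f' = "\<lambda>r. - f' (a + b - r)"])
    fix r assume r: "r \<in> {a..b}"
    have "((\<lambda>r. a + b - r) has_vector_derivative - 1) (at r within {a..b})"
      by (auto intro!: derivative_eq_intros)
    moreover have "(\<lambda>r. a + b - r) ` {a..b} = {a..b}"
      by (auto intro: image_eqI[where x = "a + b - _"])
    ultimately have "((f \<circ> (\<lambda>r. a + b - r)) has_vector_derivative (- 1) *\<^sub>R f' (a + b - r))
        (at r within {a..b})"
      using der[of "a + b - r"] r by (intro vector_diff_chain_within) auto
    then show "((\<lambda>r. f (a + b - r)) has_vector_derivative - f' (a + b - r)) (at r within {a..b})"
      by (simp add: o_def)
    show "norm (- f' (a + b - r)) \<le> L * norm (f (a + b - r)) + c"
      using bound[of "a + b - r"] r by auto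
  qed (use assms in auto)
  then show ?thesis by simp
qed

text \<open>The integral operator is made a contraction on the whole interval at once by an
  exponentially weighted sup norm (Bielecki's norm), so no short solutions have to be glued.\<close>

lemma picard_lindelof_global:
  fixes g :: "real \<Rightarrow> 'a::banach \<Rightarrow> 'a"
  assumes ab: "a \<le> b"
    and cont: "continuous_on ({a..b} \<times> UNIV) (\<lambda>(t, x). g t x)"
    and lip: "\<And>t x y. t \<in> {a..b} \<Longrightarrow> norm (g t x - g t y) \<le> L * norm (x - y)"
  shows "\<exists>x. x a = x0 \<and> (\<forall>t\<in>{a..b}. (x has_vector_derivative g t (x t)) (at t within {a..b}))"
proof -
  define K where "K = \<bar>L\<bar> + 1"
  have K: "K > 0" "L \<le> K" by (auto simp: K_def)
  have lipK: "norm (g t x - g t y) \<le> K * norm (x - y)" if "t \<in> {a..b}" for t x y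
    using lip[OF that, of x y] K(2) by (meson mult_right_mono norm_ge_zero order_trans)
  \<comment> \<open>Bounded continuous functions live on the whole line; clamping the argument to
    \<open>{a..b}\<close> extends them by their endpoint values.\<close>
  define cl where "cl t = max a (min t b)" for t :: real
  have cl: "cl t \<in> {a..b}" for t using ab by (auto simp: cl_def)
  have cl_id: "cl t = t" if "t \<in> {a..b}" for t using that by (auto simp: cl_def)
  have cont_cl: "continuous_on UNIV cl" unfolding cl_def by (intro continuous_intros)
  \<comment> \<open>The unknown \<open>f\<close> is the solution multiplied by
    \<open>exp (- 2 * K * (r - a))\<close>, which turns the weighted norm into the ordinary sup
    norm. \<open>G\<close> undoes the weight inside the field, and \<open>p\<close> below is the
    Picard operator with the weight restored.\<close>
  define G where "G f r = g r (exp (2 * K * (r - a)) *\<^sub>R f r)" for f :: "real \<Rightarrow> 'a" and r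
  have contG: "continuous_on {a..b} (G f)" if "continuous_on {a..b} f" for f
  proof -
    have "continuous_on {a..b} ((\<lambda>(t, x). g t x) \<circ> (\<lambda>r. (r, exp (2 * K * (r - a)) *\<^sub>R f r)))"
      by (intro continuous_on_compose continuous_intros that continuous_on_subset[OF cont]) auto
    then show ?thesis by (simp add: o_def G_def)
  qed
  define p where "p f u = exp (- 2 * K * (u - a)) *\<^sub>R (x0 + integral {a..u} (G f))" for f u
  have contp: "continuous_on {a..b} (p f)" if "continuous_on {a..b} f" for f
    unfolding p_def
    by (intro continuous_intros indefinite_integral_continuous_1 integrable_continuous_real contG that)
  have bc: "(\<lambda>t. p f (cl t)) \<in> bcontfun" if "continuous_on {a..b} f" for f
  proof -
    have "bounded (p f ` {a..b})"
      using contp[OF that] by (intro compact_imp_bounded compact_continuous_image) auto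
    then obtain B where "\<And>u. u \<in> {a..b} \<Longrightarrow> norm (p f u) \<le> B"
      unfolding bounded_iff by blast
    then show ?thesis
      using cl by (intro bcontfun_normI[where b = B] continuous_on_compose2[OF contp[OF that] cont_cl]) auto
  qed
  define P where "P f = Bcontfun (\<lambda>t. p (apply_bcontfun f) (cl t))" for f
  have P: "apply_bcontfun (P f) t = p (apply_bcontfun f) (cl t)" for f t
    unfolding P_def using bc[of f] by (simp add: Bcontfun_inverse)
  have "dist (P f) (P h) \<le> 1/2 * dist f h" for f h
  proof (rule dist_bound)
    fix t
    define u where "u = cl t"
    have u: "u \<in> {a..b}" unfolding u_def by (rule cl)
    have Gi: "G (apply_bcontfun k) integrable_on {a..u}" for k :: "real \<Rightarrow>\<^sub>C 'a"
      using u by (intro integrable_continuous_real continuous_on_subset[OF contG]) auto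
    \<comment> \<open>Integrating the weight yields the factor \<open>1 / (2 * K)\<close> against
      the Lipschitz constant \<open>K\<close>; this is where the contraction factor 1/2 comes
      from.\<close>
    have int: "((\<lambda>r. exp (2 * K * (r - a)) * (K * dist f h)) has_integral
        exp (2 * K * (u - a)) * (dist f h / 2) - exp (2 * K * (a - a)) * (dist f h / 2)) {a..u}"
      using u K by (intro fundamental_theorem_of_calculus)
        (auto intro!: derivative_eq_intros simp flip: has_real_derivative_iff_has_vector_derivative)
    have "norm (integral {a..u} (\<lambda>r. G f r - G h r)) \<le>
        integral {a..u} (\<lambda>r. exp (2 * K * (r - a)) * (K * dist f h))"
    proof (rule integral_norm_bound_integral)
      fix r assume r: "r \<in> {a..u}"
      have "norm (G f r - G h r) \<le> K * norm (exp (2 * K * (r - a)) *\<^sub>R f r - exp (2 * K * (r - a)) *\<^sub>R h r)"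
        unfolding G_def using r u by (intro lipK) auto
      also have "\<dots> = exp (2 * K * (r - a)) * (K * dist (f r) (h r))"
        by (simp add: dist_norm flip: scaleR_diff_right)
      also have "\<dots> \<le> exp (2 * K * (r - a)) * (K * dist f h)"
        using K by (intro mult_left_mono dist_bounded) auto
      finally show "norm (G f r - G h r) \<le> exp (2 * K * (r - a)) * (K * dist f h)" .
    qed (use Gi int in \<open>auto intro: integrable_diff\<close>)
    also have "\<dots> \<le> exp (2 * K * (u - a)) * (dist f h / 2)"
      using integral_unique[OF int] by simp
    finally have *: "norm (integral {a..u} (G f) - integral {a..u} (G h)) \<le> exp (2 * K * (u - a)) * (dist f h / 2)"
      using Gi by (simp add: integral_diff)
    have "dist (P f t) (P h t) = exp (- 2 * K * (u - a)) * norm (integral {a..u} (G f) - integral {a..u} (G h))"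
      by (simp add: P p_def dist_norm u_def flip: scaleR_diff_right)
    also have "\<dots> \<le> exp (- 2 * K * (u - a)) * (exp (2 * K * (u - a)) * (dist f h / 2))"
      using * by (intro mult_left_mono) auto
    also have "\<dots> = 1/2 * dist f h"
      by (simp flip: exp_add mult.assoc)
    finally show "dist (P f t) (P h t) \<le> 1/2 * dist f h" .
  qed
  then obtain f where f: "P f = f"
    using banach_fix_type[of "1/2" P] by auto
  define x where "x t = exp (2 * K * (t - a)) *\<^sub>R f t" for t
  have Gx: "G f = (\<lambda>r. g r (x r))"
    by (simp add: G_def x_def fun_eq_iff)
  have x: "x t = x0 + integral {a..t} (\<lambda>r. g r (x r))" if "t \<in> {a..b}" for t
    using P[of f t] f cl_id[OF that]
    unfolding Gx[symmetric] by (simp add: x_def p_def exp_minus)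
  have contgx: "continuous_on {a..b} (\<lambda>r. g r (x r))"
    using contG[of f] by (simp add: Gx)
  have "(x has_vector_derivative g t (x t)) (at t within {a..b})" if t: "t \<in> {a..b}" for t
  proof -
    have "((\<lambda>t. x0 + integral {a..t} (\<lambda>r. g r (x r))) has_vector_derivative g t (x t)) (at t within {a..b})"
      by (auto intro!: derivative_eq_intros integral_has_vector_derivative contgx t)
    then show ?thesis
      by (rule has_vector_derivative_transform[OF t, rotated]) (use x in auto)
  qed
  moreover have "x a = x0" using x[of a] ab by simp
  ultimately show ?thesis by blast
qed

section \<open>Flows of fields of linear growth\<close>

text \<open>A single constant \<open>C\<close> serves as slope and as intercept of the growth bound,
  so orbits are confined by one function of the initial norm, called \<open>reach\<close>
  below.\<close>

locale flow_field =
  fixes v :: "real \<Rightarrow> 'a::euclidean_space \<Rightarrow> 'a" and C :: real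
  assumes smooth: "cont_diff_in_space v"
    and C: "0 \<le> C"
    and growth: "\<And>t x. t \<in> {0..1} \<Longrightarrow> norm (v t x) \<le> C * norm x + C"
begin

lemma v_cont: "continuous_on ({0..1} \<times> UNIV) (\<lambda>(t, x). v t x)"
  using smooth by (simp add: cont_diff_in_space_def)

text \<open>The ordering of the times is part of the predicate, so that it need not be carried along
  separately. For \<open>s = T\<close> the derivative condition is void.\<close>

definition solves :: "real \<Rightarrow> real \<Rightarrow> (real \<Rightarrow> 'a) \<Rightarrow> bool" where
  "solves s T x \<longleftrightarrow> 0 \<le> s \<and> s \<le> T \<and> T \<le> 1 \<and>
     (\<forall>r\<in>{s..T}. (x has_vector_derivative v r (x r)) (at r within {s..T}))"

section \<open>A priori bounds, existence and uniqueness of solutions\<close>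

lemma solvesD:
  assumes "solves s T x"
  shows "0 \<le> s" "s \<le> T" "T \<le> 1"
    and "r \<in> {s..T} \<Longrightarrow> (x has_vector_derivative v r (x r)) (at r within {s..T})"
  using assms by (auto simp: solves_def)

lemma solves_subinterval:
  assumes "solves s T x" "s \<le> a" "a \<le> b" "b \<le> T"
  shows "solves a b x"
  unfolding solves_def
proof (intro conjI ballI)
  fix r assume "r \<in> {a..b}"
  then show "(x has_vector_derivative v r (x r)) (at r within {a..b})"
    using assms(2-4) by (intro has_vector_derivative_within_subset[OF solvesD(4)[OF assms(1)]]) auto
qed (use solvesD[OF assms(1)] assms(2-4) in auto)

text \<open>Gronwall's bound, over a time of length at most 1, for an orbit that starts with norm
  \<open>R\<close>.\<close>

definition reach :: "real \<Rightarrow> real" where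
  "reach R = exp C * (R + C)"

lemma reach_ge: "0 \<le> R \<Longrightarrow> R \<le> reach R"
proof -
  assume "0 \<le> R"
  then have "1 * (R + 0) \<le> exp C * (R + C)" using C by (intro mult_mono) auto
  then show ?thesis by (simp add: reach_def)
qed

lemma reach_mono: "R \<le> R' \<Longrightarrow> reach R \<le> reach R'"
  by (simp add: reach_def)

lemma exp_length_le: "0 \<le> s \<Longrightarrow> s \<le> T \<Longrightarrow> T \<le> 1 \<Longrightarrow> 0 \<le> n \<Longrightarrow> exp (C * (T - s)) * (n + C * (T - s)) \<le> reach n"
proof -
  assume "0 \<le> s" "s \<le> T" "T \<le> 1" "0 \<le> n"
  moreover from this C have "C * (T - s) \<le> C * 1" by (intro mult_left_mono) auto
  ultimately show ?thesis unfolding reach_def using C by (intro mult_mono) auto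
qed

lemma solves_bound:
  assumes "solves s T x" "r \<in> {s..T}"
  shows "norm (x r) \<le> reach (norm (x s))"
proof -
  have sol: "solves s r x" using assms by (intro solves_subinterval[OF assms(1)]) auto
  note D = solvesD[OF sol]
  have "norm (x r) \<le> exp (C * (r - s)) * (norm (x s) + C * (r - s))"
    using D by (intro gronwall[OF D(2) C C D(4)] growth) auto
  also have "\<dots> \<le> reach (norm (x s))" using D by (intro exp_length_le) auto
  finally show ?thesis .
qed

text \<open>Read contrapositively: an orbit that starts far out also ends far out. This makes
  \<open>\<psi>\<close> vanish along orbits that start far from its support.\<close>

lemma solves_bound_backward:
  assumes "solves s T x"
  shows "norm (x s) \<le> reach (norm (x T))"
proof -
  note D = solvesD[OF assms]
  have "norm (x s) \<le> exp (C * (T - s)) * (norm (x T) + C * (T - s))"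
    using D by (intro gronwall_backward[OF D(2) C C D(4)] growth) auto
  also have "\<dots> \<le> reach (norm (x T))" using D by (intro exp_length_le) auto
  finally show ?thesis .
qed

text \<open>The field is only locally Lipschitz. Composing it with the projection onto a ball makes
  it globally Lipschitz and keeps the growth bound, since the projection does not increase norms.
  Gronwall then confines the solution to the ball, where the projection is the identity and the
  original equation holds.\<close>

lemma solves_exists:
  assumes s: "0 \<le> s" "s \<le> T" "T \<le> 1"
  shows "\<exists>x. x s = x0 \<and> solves s T x"
proof -
  define R where "R = reach (norm x0)"
  have R: "0 \<le> R" using reach_ge[of "norm x0"] by (simp add: R_def order_trans[OF norm_ge_zero])
  obtain L where "L \<ge> 0"
    and L: "\<And>t x y. t \<in> {0..1} \<Longrightarrow> norm x \<le> R \<Longrightarrow> norm y \<le> R \<Longrightarrow> norm (v t x - v t y) \<le> L * norm (x - y)"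
    by (rule cont_diff_in_space_lipschitz[OF smooth, of R]) (rule that)
  define c where "c = closest_point (cball (0::'a) R)"
  have c_in: "norm (c x) \<le> R" for x
    using closest_point_in_set[of "cball (0::'a) R" x] R by (simp add: c_def)
  have c_lip: "norm (c x - c y) \<le> norm (x - y)" for x y
    using closest_point_lipschitz[of "cball (0::'a) R" x y] R by (simp add: c_def dist_norm)
  have c_self: "c x = x" if "norm x \<le> R" for x
    using that by (simp add: c_def closest_point_self)
  have c_cont: "continuous_on UNIV c"
    using R by (auto simp: c_def intro!: continuous_on_closest_point)
  have "\<exists>x. x s = x0 \<and> (\<forall>t\<in>{s..T}. (x has_vector_derivative v t (c (x t))) (at t within {s..T}))"
  proof (rule picard_lindelof_global[OF s(2)])
    have "continuous_on ({s..T} \<times> UNIV) ((\<lambda>(t, x). v t x) \<circ> (\<lambda>w. (fst w, c (snd w))))"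
      using s by (intro continuous_on_compose continuous_intros continuous_on_subset[OF v_cont]
          continuous_on_compose2[OF c_cont]) auto
    then show "continuous_on ({s..T} \<times> UNIV) (\<lambda>(t, x). v t (c x))"
      by (simp add: o_def case_prod_unfold)
    fix t x y assume "t \<in> {s..T}"
    then have "norm (v t (c x) - v t (c y)) \<le> L * norm (c x - c y)"
      using s c_in by (intro L) auto
    also have "\<dots> \<le> L * norm (x - y)" using \<open>L \<ge> 0\<close> c_lip by (intro mult_left_mono) auto
    finally show "norm (v t (c x) - v t (c y)) \<le> L * norm (x - y)" .
  qed
  then obtain x where x: "x s = x0"
    and der: "\<And>t. t \<in> {s..T} \<Longrightarrow> (x has_vector_derivative v t (c (x t))) (at t within {s..T})"
    by blast
  have "norm (x r) \<le> R" if r: "r \<in> {s..T}" for r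
  proof -
    have "norm (x r) \<le> exp (C * (r - s)) * (norm (x s) + C * (r - s))"
    proof (rule gronwall[OF _ C C])
      fix t assume t: "t \<in> {s..r}"
      then show "(x has_vector_derivative v t (c (x t))) (at t within {s..r})"
        using r by (intro has_vector_derivative_within_subset[OF der]) auto
      have "norm (v t (c (x t))) \<le> C * norm (c (x t)) + C"
        using t r s by (intro growth) auto
      also have "norm (c (x t)) \<le> norm (x t)"
        using c_lip[of "x t" 0] c_self[of 0] R by simp
      finally show "norm (v t (c (x t))) \<le> C * norm (x t) + C"
        using C by (simp add: mult_left_mono)
    qed (use r in auto)
    also have "\<dots> \<le> R" unfolding R_def x using r s by (intro exp_length_le) auto
    finally show ?thesis .
  qed
  then have "solves s T x"
    using der s by (auto simp: solves_def c_self)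
  with x show ?thesis by blast
qed

text \<open>Two orbits that start in the ball of radius \<open>R\<close> stay in the ball of radius
  \<open>reach R\<close>. The Lipschitz constant of the field there drives a Gronwall estimate for
  their difference, so \<open>K\<close> depends on \<open>R\<close> alone.\<close>

lemma solves_lipschitz:
  obtains K where "K \<ge> 0"
    and "\<And>s T x y r. solves s T x \<Longrightarrow> solves s T y \<Longrightarrow> norm (x s) \<le> R \<Longrightarrow> norm (y s) \<le> R \<Longrightarrow> r \<in> {s..T} \<Longrightarrow>
      norm (x r - y r) \<le> K * norm (x s - y s)"
proof -
  obtain L where L0: "L \<ge> 0" and L: "\<And>t x y. t \<in> {0..1} \<Longrightarrow> norm x \<le> reach R \<Longrightarrow> norm y \<le> reach R \<Longrightarrow>
      norm (v t x - v t y) \<le> L * norm (x - y)"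
    by (rule cont_diff_in_space_lipschitz[OF smooth, of "reach R"]) (rule that)
  show thesis
  proof
    show "exp L \<ge> 0" by simp
    fix s T x y r assume x: "solves s T x" and y: "solves s T y"
      and R: "norm (x s) \<le> R" "norm (y s) \<le> R" and r: "r \<in> {s..T}"
    have xr: "solves s r x" and yr: "solves s r y"
      using r by (auto intro: solves_subinterval[OF x] solves_subinterval[OF y])
    have "norm (x r - y r) \<le> exp (L * (r - s)) * (norm (x s - y s) + 0 * (r - s))"
    proof (rule gronwall[OF _ L0 order_refl])
      fix t assume t: "t \<in> {s..r}"
      show "((\<lambda>t. x t - y t) has_vector_derivative v t (x t) - v t (y t)) (at t within {s..r})"
        using t by (intro has_vector_derivative_diff solvesD(4)[OF xr] solvesD(4)[OF yr])
      have "norm (x t) \<le> reach R" "norm (y t) \<le> reach R"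
        using solves_bound[OF xr t] solves_bound[OF yr t] R reach_mono order_trans by blast+
      then show "norm (v t (x t) - v t (y t)) \<le> L * norm (x t - y t) + 0"
        using L[of t "x t" "y t"] t solvesD(1-3)[OF xr] by auto
    qed (use r in auto)
    also have "\<dots> \<le> exp L * norm (x s - y s)"
      using L0 solvesD(1-3)[OF xr] by (auto intro!: mult_right_mono mult_left_le)
    finally show "norm (x r - y r) \<le> exp L * norm (x s - y s)" .
  qed
qed

lemma solves_unique:
  assumes "solves s T x" "solves s T y" "x s = y s" "r \<in> {s..T}"
  shows "x r = y r"
proof -
  obtain K where "K \<ge> 0" and K: "\<And>s' T x' y' r. solves s' T x' \<Longrightarrow> solves s' T y' \<Longrightarrow> norm (x' s') \<le> norm (y s) \<Longrightarrow>
      norm (y' s') \<le> norm (y s) \<Longrightarrow> r \<in> {s'..T} \<Longrightarrow> norm (x' r - y' r) \<le> K * norm (x' s' - y' s')"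
    by (rule solves_lipschitz[of "norm (y s)"]) (rule that)
  from K[of s T x y r] assms show ?thesis by simp
qed

text \<open>The choice is made on all of \<open>{s..1}\<close> and does not depend on
  \<open>T\<close>, so that \<open>\<lambda>T. flow s T y\<close> is one single solution.\<close>

definition flow :: "real \<Rightarrow> real \<Rightarrow> 'a \<Rightarrow> 'a" where
  "flow s T y = (SOME x. x s = y \<and> solves s 1 x) T"

lemma flow_solves:
  assumes "0 \<le> s" "s \<le> 1"
  shows "flow s s y = y" "solves s 1 (\<lambda>T. flow s T y)"
  using someI_ex[OF solves_exists[OF assms order_refl, of y]] by (simp_all add: flow_def eta_contract_eq)

text \<open>The Lipschitz constant depends on the ball, so continuity is obtained on each open ball
  and then on their union.\<close>

lemma continuous_on_flow:
  assumes "0 \<le> s" "s \<le> T" "T \<le> 1"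
  shows "continuous_on UNIV (flow s T)"
proof -
  have "continuous_on (ball 0 R) (flow s T)" for R
  proof -
    obtain K where K: "K \<ge> 0" "\<And>s T x y r. solves s T x \<Longrightarrow> solves s T y \<Longrightarrow> norm (x s) \<le> R \<Longrightarrow>
        norm (y s) \<le> R \<Longrightarrow> r \<in> {s..T} \<Longrightarrow> norm (x r - y r) \<le> K * norm (x s - y s)"
      by (rule solves_lipschitz[of R]) (rule that)
    have "dist (flow s T x) (flow s T y) \<le> K * dist x y" if "x \<in> ball 0 R" "y \<in> ball 0 R" for x y
      using K(2)[OF flow_solves(2) flow_solves(2), of s x y T] that assms
      by (auto simp: flow_solves(1) dist_norm)
    then have "K-lipschitz_on (ball 0 R) (flow s T)"
      using K(1) by (intro lipschitz_onI) auto
    then show ?thesis by (rule lipschitz_on_continuous_on)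
  qed
  then have "continuous_on (\<Union>R\<in>UNIV. ball 0 R) (flow s T)"
    by (intro continuous_on_open_UN) auto
  moreover have "(\<Union>R\<in>UNIV. ball (0::'a) R) = UNIV"
    using gt_ex by fastforce
  ultimately show ?thesis by simp
qed

text \<open>The Gronwall argument of the overview. The difference \<open>Z\<close> between the
  weighted mean of the orbits \<open>\<xi> i\<close> and the orbit \<open>\<zeta>\<close> obeys a
  linear differential inequality with a defect proportional to \<open>d\<close>: the orbits stay
  within \<open>K * d\<close> of each other, and on this scale the field is affine up to a small
  error. At the final time the same approximation is applied to \<open>\<psi>\<close>.\<close>

lemma flow_approx_affine:
  fixes \<psi> :: "'a \<Rightarrow> 'b::real_normed_vector"
  assumes \<psi>: "cont_diff_in_space (\<lambda>_. \<psi>)" and "R \<ge> 0"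
  obtains M where "M \<ge> 0"
    and "\<And>\<epsilon>. \<epsilon> > 0 \<Longrightarrow> \<exists>\<delta>>0. \<forall>s T \<zeta> d. \<forall>I::'i set. \<forall>p \<xi>.
      solves s T \<zeta> \<longrightarrow> norm (\<zeta> s) \<le> R \<longrightarrow> 0 \<le> d \<longrightarrow> d < \<delta> \<longrightarrow>
      (\<forall>i\<in>I. 0 \<le> p i \<and> solves s T (\<xi> i) \<and> norm (\<xi> i s) \<le> R \<and> norm (\<xi> i s - \<zeta> s) \<le> d) \<longrightarrow> sum p I = 1 \<longrightarrow>
      norm ((\<Sum>i\<in>I. p i *\<^sub>R \<psi> (\<xi> i T)) - \<psi> (\<zeta> T)) \<le> M * norm ((\<Sum>i\<in>I. p i *\<^sub>R \<xi> i s) - \<zeta> s) + \<epsilon> * d"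
proof -
  define S where "S = reach R"
  obtain L where L: "L \<ge> 0"
    and vL: "\<And>\<epsilon>. \<epsilon> > 0 \<Longrightarrow> \<exists>\<delta>>0. \<forall>t\<in>{0..1}. \<forall>z d. \<forall>I::'i set. \<forall>p y. norm z \<le> S \<longrightarrow> d < \<delta> \<longrightarrow>
      (\<forall>i\<in>I. 0 \<le> p i \<and> norm (y i) \<le> S \<and> norm (y i - z) \<le> d) \<longrightarrow> sum p I = 1 \<longrightarrow>
      norm ((\<Sum>i\<in>I. p i *\<^sub>R v t (y i)) - v t z) \<le> L * norm ((\<Sum>i\<in>I. p i *\<^sub>R y i) - z) + \<epsilon> * d"
    by (rule cont_diff_in_space_approx_affine[OF smooth, where R = S]) (rule that)
  obtain N where N: "N \<ge> 0"
    and \<psi>N: "\<And>\<epsilon>. \<epsilon> > 0 \<Longrightarrow> \<exists>\<delta>>0. \<forall>t\<in>{0..1::real}. \<forall>z d. \<forall>I::'i set. \<forall>p y. norm z \<le> S \<longrightarrow> d < \<delta> \<longrightarrow>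
      (\<forall>i\<in>I. 0 \<le> p i \<and> norm (y i) \<le> S \<and> norm (y i - z) \<le> d) \<longrightarrow> sum p I = 1 \<longrightarrow>
      norm ((\<Sum>i\<in>I. p i *\<^sub>R \<psi> (y i)) - \<psi> z) \<le> N * norm ((\<Sum>i\<in>I. p i *\<^sub>R y i) - z) + \<epsilon> * d"
    by (rule cont_diff_in_space_approx_affine[OF \<psi>, where R = S]) (rule that)
  obtain K where K: "K \<ge> 0"
    and Klip: "\<And>s T x y r. solves s T x \<Longrightarrow> solves s T y \<Longrightarrow> norm (x s) \<le> R \<Longrightarrow> norm (y s) \<le> R \<Longrightarrow> r \<in> {s..T} \<Longrightarrow>
      norm (x r - y r) \<le> K * norm (x s - y s)"
    by (rule solves_lipschitz[of R]) (rule that)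
  show thesis
  proof
    show "N * exp L \<ge> 0" using N by simp
    fix \<epsilon> :: real assume \<epsilon>: "\<epsilon> > 0"
    \<comment> \<open>The error is split in halves: \<open>\<epsilon>1\<close> for the defect of the
      field, which is amplified by \<open>N * exp L * K\<close>, and \<open>\<epsilon>2\<close> for
      that of \<open>\<psi>\<close>, which is amplified by \<open>K\<close>. Adding 1 keeps the
      denominators positive.\<close>
    define \<epsilon>1 where "\<epsilon>1 = \<epsilon> / 2 / (N * exp L * K + 1)"
    define \<epsilon>2 where "\<epsilon>2 = \<epsilon> / 2 / (K + 1)"
    have pos: "\<epsilon>1 > 0" "\<epsilon>2 > 0" using \<epsilon> N K by (auto simp: \<epsilon>1_def \<epsilon>2_def add_nonneg_pos)
    have le: "N * exp L * \<epsilon>1 * K + \<epsilon>2 * K \<le> \<epsilon>"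
    proof -
      have half: "\<epsilon> / 2 / (x + 1) * x \<le> \<epsilon> / 2" if "x \<ge> 0" for x
        using that \<epsilon> by (simp add: field_simps)
      have "\<epsilon>1 * (N * exp L * K) \<le> \<epsilon> / 2" "\<epsilon>2 * K \<le> \<epsilon> / 2"
        unfolding \<epsilon>1_def \<epsilon>2_def by (rule half, use N K in simp)+
      moreover have "N * exp L * \<epsilon>1 * K = \<epsilon>1 * (N * exp L * K)" by (simp add: mult_ac)
      ultimately show ?thesis by linarith
    qed
    obtain \<delta>1 where \<delta>1: "\<delta>1 > 0" and v1: "\<And>t z d I p y. t \<in> {0..1} \<Longrightarrow> norm z \<le> S \<Longrightarrow> d < \<delta>1 \<Longrightarrow>
      (\<forall>i\<in>(I::'i set). 0 \<le> p i \<and> norm (y i) \<le> S \<and> norm (y i - z) \<le> d) \<Longrightarrow> sum p I = 1 \<Longrightarrow>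
      norm ((\<Sum>i\<in>I. p i *\<^sub>R v t (y i)) - v t z) \<le> L * norm ((\<Sum>i\<in>I. p i *\<^sub>R y i) - z) + \<epsilon>1 * d"
      using vL[OF pos(1)] by blast
    obtain \<delta>2 where \<delta>2: "\<delta>2 > 0" and \<psi>2: "\<And>t z d I p y. t \<in> {0..1::real} \<Longrightarrow> norm z \<le> S \<Longrightarrow> d < \<delta>2 \<Longrightarrow>
      (\<forall>i\<in>(I::'i set). 0 \<le> p i \<and> norm (y i) \<le> S \<and> norm (y i - z) \<le> d) \<Longrightarrow> sum p I = 1 \<Longrightarrow>
      norm ((\<Sum>i\<in>I. p i *\<^sub>R \<psi> (y i)) - \<psi> z) \<le> N * norm ((\<Sum>i\<in>I. p i *\<^sub>R y i) - z) + \<epsilon>2 * d"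
      using \<psi>N[OF pos(2)] by blast
    \<comment> \<open>Distances grow by at most the factor \<open>K\<close> along the flow, so this
      keeps them below both thresholds at all times.\<close>
    define \<delta> where "\<delta> = min \<delta>1 \<delta>2 / (K + 1)"
    have \<delta>: "\<delta> > 0" using \<delta>1 \<delta>2 K by (simp add: \<delta>_def)
    show "\<exists>\<delta>>0. \<forall>s T \<zeta> d. \<forall>I::'i set. \<forall>p \<xi>.
      solves s T \<zeta> \<longrightarrow> norm (\<zeta> s) \<le> R \<longrightarrow> 0 \<le> d \<longrightarrow> d < \<delta> \<longrightarrow>
      (\<forall>i\<in>I. 0 \<le> p i \<and> solves s T (\<xi> i) \<and> norm (\<xi> i s) \<le> R \<and> norm (\<xi> i s - \<zeta> s) \<le> d) \<longrightarrow> sum p I = 1 \<longrightarrow>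
      norm ((\<Sum>i\<in>I. p i *\<^sub>R \<psi> (\<xi> i T)) - \<psi> (\<zeta> T)) \<le> N * exp L * norm ((\<Sum>i\<in>I. p i *\<^sub>R \<xi> i s) - \<zeta> s) + \<epsilon> * d"
    proof (intro exI[of _ \<delta>] conjI allI impI \<delta>)
      fix s T d :: real and \<zeta> and I :: "'i set" and p :: "'i \<Rightarrow> real" and \<xi> :: "'i \<Rightarrow> real \<Rightarrow> 'a"
      assume \<zeta>: "solves s T \<zeta>" "norm (\<zeta> s) \<le> R" and d: "0 \<le> d" "d < \<delta>" and p: "sum p I = 1"
        and \<xi>: "\<forall>i\<in>I. 0 \<le> p i \<and> solves s T (\<xi> i) \<and> norm (\<xi> i s) \<le> R \<and> norm (\<xi> i s - \<zeta> s) \<le> d"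
      define Z where "Z r = (\<Sum>i\<in>I. p i *\<^sub>R \<xi> i r) - \<zeta> r" for r
      note sT = solvesD(1-3)[OF \<zeta>(1)]
      have Kd: "K * d < \<delta>1" "K * d < \<delta>2"
      proof -
        have "K * d \<le> (K + 1) * d" using d by (simp add: algebra_simps)
        also have "\<dots> < (K + 1) * \<delta>" using d K by (intro mult_strict_left_mono) auto
        also have "\<dots> = min \<delta>1 \<delta>2" using K by (simp add: \<delta>_def)
        finally show "K * d < \<delta>1" "K * d < \<delta>2" by auto
      qed
      have in_S: "norm (\<zeta> r) \<le> S" if "r \<in> {s..T}" for r
        unfolding S_def using solves_bound[OF \<zeta>(1) that] reach_mono[OF \<zeta>(2)] by linarith
      have close: "0 \<le> p i \<and> norm (\<xi> i r) \<le> S \<and> norm (\<xi> i r - \<zeta> r) \<le> K * d"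
        if "r \<in> {s..T}" "i \<in> I" for r i
      proof (intro conjI)
        have i: "0 \<le> p i" "solves s T (\<xi> i)" "norm (\<xi> i s) \<le> R" "norm (\<xi> i s - \<zeta> s) \<le> d"
          using \<xi> that(2) by auto
        show "0 \<le> p i" by (rule i)
        show "norm (\<xi> i r) \<le> S"
          unfolding S_def using solves_bound[OF i(2) that(1)] reach_mono[OF i(3)] by linarith
        show "norm (\<xi> i r - \<zeta> r) \<le> K * d"
          using Klip[OF i(2) \<zeta>(1) i(3) \<zeta>(2) that(1)] mult_left_mono[OF i(4) K] by linarith
      qed
      have "norm (Z T) \<le> exp (L * (T - s)) * (norm (Z s) + \<epsilon>1 * (K * d) * (T - s))"
      proof (rule gronwall)
        fix r assume r: "r \<in> {s..T}"
        show "(Z has_vector_derivative (\<Sum>i\<in>I. p i *\<^sub>R v r (\<xi> i r)) - v r (\<zeta> r)) (at r within {s..T})"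
          unfolding Z_def using \<xi> r
          by (intro has_vector_derivative_diff has_vector_derivative_sum solvesD(4)[OF \<zeta>(1)]
              bounded_linear.has_vector_derivative[OF bounded_linear_scaleR_right] solvesD(4)) auto
        show "norm ((\<Sum>i\<in>I. p i *\<^sub>R v r (\<xi> i r)) - v r (\<zeta> r)) \<le> L * norm (Z r) + \<epsilon>1 * (K * d)"
          unfolding Z_def using r sT close by (intro v1 in_S Kd p) auto
      qed (use sT L pos K d in auto)
      also have "\<dots> \<le> exp L * (norm (Z s) + \<epsilon>1 * (K * d))"
      proof (rule mult_mono)
        show "exp (L * (T - s)) \<le> exp L" using sT L by (simp add: mult_left_le)
        have "\<epsilon>1 * (K * d) * (T - s) \<le> \<epsilon>1 * (K * d)"
          using sT pos K d by (intro mult_left_le) auto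
        then show "norm (Z s) + \<epsilon>1 * (K * d) * (T - s) \<le> norm (Z s) + \<epsilon>1 * (K * d)" by simp
      qed (use sT pos K d in auto)
      finally have ZT: "norm (Z T) \<le> exp L * (norm (Z s) + \<epsilon>1 * (K * d))" .
      \<comment> \<open>As \<open>\<psi>\<close> does not depend on time, its estimate is taken at
        time 0, an arbitrary element of \<open>{0..1}\<close>.\<close>
      have "norm ((\<Sum>i\<in>I. p i *\<^sub>R \<psi> (\<xi> i T)) - \<psi> (\<zeta> T)) \<le> N * norm (Z T) + \<epsilon>2 * (K * d)"
        unfolding Z_def using sT close by (intro \<psi>2[of 0] in_S Kd p) auto
      also have "\<dots> \<le> N * (exp L * (norm (Z s) + \<epsilon>1 * (K * d))) + \<epsilon>2 * (K * d)"
        using ZT N by (intro add_right_mono mult_left_mono)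
      also have "\<dots> = N * exp L * norm (Z s) + (N * exp L * \<epsilon>1 * K + \<epsilon>2 * K) * d"
        by (simp add: algebra_simps)
      also have "\<dots> \<le> N * exp L * norm (Z s) + \<epsilon> * d"
        using le d by (intro add_left_mono mult_right_mono)
      finally show "norm ((\<Sum>i\<in>I. p i *\<^sub>R \<psi> (\<xi> i T)) - \<psi> (\<zeta> T)) \<le>
          N * exp L * norm ((\<Sum>i\<in>I. p i *\<^sub>R \<xi> i s) - \<zeta> s) + \<epsilon> * d"
        by (simp add: Z_def)
    qed
  qed
qed

text \<open>The speed along an orbit from the ball of radius \<open>R\<close> is at most
  \<open>C * reach R + C\<close>; Gronwall with \<open>L = 0\<close> integrates it.\<close>

lemma solves_displacement:
  assumes x: "solves s T x" and R: "norm (x s) \<le> R"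
  shows "norm (x T - x s) \<le> (T - s) * (C * reach R + C)"
proof -
  note sT = solvesD(1-3)[OF x]
  have B: "C * reach R + C \<ge> 0"
    using C R reach_ge[of R] norm_ge_zero[of "x s"] by (intro add_nonneg_nonneg mult_nonneg_nonneg) linarith+
  have "norm (x T - x s) \<le> exp (0 * (T - s)) * (norm (x s - x s) + (C * reach R + C) * (T - s))"
  proof (rule gronwall[OF sT(2) order_refl B])
    fix r assume r: "r \<in> {s..T}"
    show "((\<lambda>r. x r - x s) has_vector_derivative v r (x r)) (at r within {s..T})"
      using has_vector_derivative_diff[OF solvesD(4)[OF x r] has_vector_derivative_const] by simp
    have "norm (v r (x r)) \<le> C * norm (x r) + C" using r sT by (intro growth) auto
    also have "norm (x r) \<le> reach R"
      using solves_bound[OF x r] reach_mono[OF R] by linarith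
    finally show "norm (v r (x r)) \<le> 0 * norm (x r - x s) + (C * reach R + C)"
      using C by (simp add: mult_left_mono)
  qed
  then show ?thesis by (simp add: mult.commute)
qed

text \<open>One Euler step is accurate to first order, uniformly over starting times and starting
  points in a ball, because the field is uniformly continuous on the compact set that the orbits do
  not leave.\<close>

lemma solves_first_order:
  assumes "\<epsilon> > 0" "R \<ge> 0"
  shows "\<exists>\<eta>>0. \<forall>s T x. solves s T x \<longrightarrow> norm (x s) \<le> R \<longrightarrow> T - s < \<eta> \<longrightarrow>
    norm (x s + (T - s) *\<^sub>R v s (x s) - x T) \<le> \<epsilon> * (T - s)"
proof -
  define K where "K = {0..1::real} \<times> cball (0::'a) (reach R)"
  have K: "compact K" unfolding K_def by (intro compact_Times compact_cball) simp
  have "uniformly_continuous_on K (\<lambda>(t, x). v t x)"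
    by (intro compact_uniformly_continuous K continuous_on_subset[OF v_cont]) (auto simp: K_def)
  then obtain \<delta> where \<delta>: "\<delta> > 0"
    and v: "\<And>w w'. w \<in> K \<Longrightarrow> w' \<in> K \<Longrightarrow> dist w' w < \<delta> \<Longrightarrow>
        dist (case w' of (t, x) \<Rightarrow> v t x) (case w of (t, x) \<Rightarrow> v t x) < \<epsilon>"
    using \<open>\<epsilon> > 0\<close> unfolding uniformly_continuous_on_def by metis
  define B where "B = C * reach R + C"
  have B: "B \<ge> 0"
    unfolding B_def using C assms(2) reach_ge[of R] by (intro add_nonneg_nonneg mult_nonneg_nonneg) linarith+
  show ?thesis
  \<comment> \<open>After a time \<open>h\<close> the pair of time and position has moved by at most
    \<open>h * (1 + B)\<close>, where \<open>B\<close> bounds the speed.\<close>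
  proof (intro exI[of _ "\<delta> / (1 + B)"] conjI allI impI)
    show "\<delta> / (1 + B) > 0" using \<delta> B by simp
    fix s T x assume x: "solves s T x" and R: "norm (x s) \<le> R" and T: "T - s < \<delta> / (1 + B)"
    note sT = solvesD(1-3)[OF x]
    have "norm (x s + (T - s) *\<^sub>R v s (x s) - x T) \<le>
        exp (0 * (T - s)) * (norm (x s + (s - s) *\<^sub>R v s (x s) - x s) + \<epsilon> * (T - s))"
    proof (rule gronwall[OF sT(2) order_refl])
      fix r assume r: "r \<in> {s..T}"
      have "((\<lambda>r. x s + (r - s) *\<^sub>R v s (x s) - x r) has_vector_derivative 0 + ((r - s) *\<^sub>R 0 + 1 *\<^sub>R v s (x s)) - v r (x r)) (at r within {s..T})"
        by (intro has_vector_derivative_diff has_vector_derivative_add has_vector_derivative_const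
            has_vector_derivative_scaleR solvesD(4)[OF x r])
          (auto intro!: derivative_eq_intros)
      then show "((\<lambda>r. x s + (r - s) *\<^sub>R v s (x s) - x r) has_vector_derivative v s (x s) - v r (x r)) (at r within {s..T})"
        by simp
      have xr: "solves s r x" using r by (intro solves_subinterval[OF x]) auto
      have "norm (x r - x s) \<le> (r - s) * B"
        unfolding B_def by (rule solves_displacement[OF xr R])
      then have "dist (s, x s) (r, x r) \<le> (r - s) + (r - s) * B"
        using r by (intro order_trans[OF dist_triangle[of _ _ "(r, x s)"]])
          (auto simp: dist_Pair_Pair dist_norm norm_minus_commute)
      also have "\<dots> = (r - s) * (1 + B)" by (simp add: algebra_simps)
      also have "\<dots> \<le> (T - s) * (1 + B)" using r B by (intro mult_right_mono) auto
      also have "\<dots> < \<delta>" using T B by (simp add: field_simps)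
      finally have "dist (s, x s) (r, x r) < \<delta>" .
      moreover have "norm (x s) \<le> reach R" using R reach_ge[of R] assms(2) by linarith
      moreover have "norm (x r) \<le> reach R"
        using solves_bound[OF x r] reach_mono[OF R] by linarith
      ultimately have "dist (v s (x s)) (v r (x r)) < \<epsilon>"
        using v[of "(r, x r)" "(s, x s)"] r sT by (auto simp: K_def)
      then show "norm (v s (x s) - v r (x r)) \<le> 0 * norm (x s + (r - s) *\<^sub>R v s (x s) - x r) + \<epsilon>"
        by (simp add: dist_norm)
    qed (use \<open>\<epsilon> > 0\<close> in auto)
    then show "norm (x s + (T - s) *\<^sub>R v s (x s) - x T) \<le> \<epsilon> * (T - s)" by simp
  qed
qed

end

text \<open>
  In the locale below, \<open>\<mu> t\<close> is the law at time \<open>t\<close> of a random particle moving along straight lines: given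
  that it is at \<open>x\<close>, its velocity is \<open>u t i x\<close> with probability \<open>p t i x\<close>. The assumption \<open>step\<close> is an
  exact one-step formula, which holds for finite steps because the lines are traversed at constant speed.
\<close>

locale superposition = flow_field v C
  for v :: "real \<Rightarrow> 'a::euclidean_space \<Rightarrow> 'a" and C :: real +
  fixes I :: "'i set" and p :: "real \<Rightarrow> 'i \<Rightarrow> 'a \<Rightarrow> real" and u :: "real \<Rightarrow> 'i \<Rightarrow> 'a \<Rightarrow> 'a"
    and \<mu> :: "real \<Rightarrow> 'a measure"
  assumes I: "finite I"
    and p_nonneg: "\<And>t i x. t \<in> {0..1} \<Longrightarrow> i \<in> I \<Longrightarrow> 0 \<le> p t i x"
    and p_sum: "\<And>t x. t \<in> {0..1} \<Longrightarrow> (\<Sum>i\<in>I. p t i x) = 1"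
    and v_eq: "\<And>t x. t \<in> {0..1} \<Longrightarrow> v t x = (\<Sum>i\<in>I. p t i x *\<^sub>R u t i x)"
    and u_growth: "\<And>t i x. t \<in> {0..1} \<Longrightarrow> i \<in> I \<Longrightarrow> norm (u t i x) \<le> C * norm x + C"
    and p_meas: "\<And>t i. t \<in> {0..1} \<Longrightarrow> i \<in> I \<Longrightarrow> p t i \<in> borel_measurable borel"
    and u_meas: "\<And>t i. t \<in> {0..1} \<Longrightarrow> i \<in> I \<Longrightarrow> u t i \<in> borel_measurable borel"
    and \<mu>_prob: "\<And>t. t \<in> {0..1} \<Longrightarrow> prob_space (\<mu> t)"
    and \<mu>_sets: "\<And>t. t \<in> {0..1} \<Longrightarrow> sets (\<mu> t) = sets borel"
    and step: "\<And>s t g. 0 \<le> s \<Longrightarrow> s \<le> t \<Longrightarrow> t \<le> 1 \<Longrightarrow> continuous_on UNIV g \<Longrightarrow>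
      (\<And>x. 0 \<le> g x \<and> g x \<le> 1) \<Longrightarrow>
      (\<integral>x. g x \<partial>\<mu> t) = (\<integral>x. (\<Sum>i\<in>I. p s i x * g (x + (t - s) *\<^sub>R u s i x)) \<partial>\<mu> s)"
begin

text \<open>The bound is uniform over the whole space. For \<open>y\<close> in a large ball,
  \<open>flow_approx_affine\<close> compares the orbits from the jump targets with the orbit from
  \<open>y\<close>, all taken from time \<open>t\<close> on; their barycentre is an Euler step,
  hence close to the true orbit. For \<open>y\<close> outside the ball every term vanishes.\<close>

lemma one_step_estimate:
  fixes \<psi> :: "'a \<Rightarrow> real"
  assumes \<psi>: "cont_diff_in_space (\<lambda>_. \<psi>)" and supp: "\<And>x. norm x > R0 \<Longrightarrow> \<psi> x = 0" and "R0 \<ge> 0"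
    and \<epsilon>: "\<epsilon> > 0"
  shows "\<exists>\<eta>>0. \<forall>s t T y. 0 \<le> s \<longrightarrow> s \<le> t \<longrightarrow> t \<le> T \<longrightarrow> T \<le> 1 \<longrightarrow> t - s < \<eta> \<longrightarrow>
    \<bar>(\<Sum>i\<in>I. p s i y * \<psi> (flow t T (y + (t - s) *\<^sub>R u s i y))) - \<psi> (flow s T y)\<bar> \<le> \<epsilon> * (t - s)"
proof -
  \<comment> \<open>With steps such that \<open>h * C \<le> 1 / 2\<close>, a jump from
    \<open>y\<close> lands at norm at least \<open>(norm y - 1) / 2\<close>. For
    \<open>norm y > R\<close> this exceeds \<open>reach R0\<close>, so the orbit misses the support
    of \<open>\<psi>\<close>.\<close>
  define R where "R = 2 * reach R0 + 1"
  define D1 where "D1 = C * R + C"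
  define D2 where "D2 = C * reach R + C"
  \<comment> \<open>For \<open>norm y \<le> R\<close>, \<open>D1\<close> bounds the velocities of
    the jumps and \<open>D2\<close> the speed of the orbit, so after time \<open>h\<close> the two
    positions differ by at most \<open>h * D\<close>. The radius \<open>R'\<close> accommodates
    both.\<close>
  define D where "D = D1 + D2"
  define R' where "R' = R + D1 + reach R"
  have reach0: "reach R0 \<ge> 0" using reach_ge[OF \<open>R0 \<ge> 0\<close>] \<open>R0 \<ge> 0\<close> by linarith
  have R: "R \<ge> 0" using reach0 by (simp add: R_def)
  have reachR: "reach R \<ge> 0" using reach_ge[OF R] R by linarith
  have D12: "D1 \<ge> 0" "D2 \<ge> 0" using C R reachR by (simp_all add: D1_def D2_def)
  have D: "D \<ge> 0" using D12 by (simp add: D_def)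
  have R': "R' \<ge> 0" using R D12 reachR by (simp add: R'_def)
  obtain M where M: "M \<ge> 0"
    and aff: "\<And>\<epsilon>. \<epsilon> > 0 \<Longrightarrow> \<exists>\<delta>>0. \<forall>s T \<zeta> d. \<forall>I::'i set. \<forall>p \<xi>.
      solves s T \<zeta> \<longrightarrow> norm (\<zeta> s) \<le> R' \<longrightarrow> 0 \<le> d \<longrightarrow> d < \<delta> \<longrightarrow>
      (\<forall>i\<in>I. 0 \<le> p i \<and> solves s T (\<xi> i) \<and> norm (\<xi> i s) \<le> R' \<and> norm (\<xi> i s - \<zeta> s) \<le> d) \<longrightarrow> sum p I = 1 \<longrightarrow>
      norm ((\<Sum>i\<in>I. p i *\<^sub>R \<psi> (\<xi> i T)) - \<psi> (\<zeta> T)) \<le> M * norm ((\<Sum>i\<in>I. p i *\<^sub>R \<xi> i s) - \<zeta> s) + \<epsilon> * d"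
    by (rule flow_approx_affine[OF \<psi> R']) (rule that)
  define \<epsilon>1 where "\<epsilon>1 = \<epsilon> / 2 / (M + 1)"
  define \<epsilon>2 where "\<epsilon>2 = \<epsilon> / 2 / (D + 1)"
  have pos: "\<epsilon>1 > 0" "\<epsilon>2 > 0" using \<epsilon> M D by (auto simp: \<epsilon>1_def \<epsilon>2_def)
  have le: "M * \<epsilon>1 + \<epsilon>2 * D \<le> \<epsilon>"
  proof -
    have half: "\<epsilon> / 2 / (x + 1) * x \<le> \<epsilon> / 2" if "x \<ge> 0" for x
      using that \<epsilon> by (simp add: field_simps)
    have "\<epsilon>1 * M \<le> \<epsilon> / 2" "\<epsilon>2 * D \<le> \<epsilon> / 2"
      unfolding \<epsilon>1_def \<epsilon>2_def by (rule half, use M D in simp)+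
    then show ?thesis by (simp add: mult.commute)
  qed
  obtain \<delta> where \<delta>: "\<delta> > 0" and aff': "\<And>s T \<zeta> d I p \<xi>.
      solves s T \<zeta> \<Longrightarrow> norm (\<zeta> s) \<le> R' \<Longrightarrow> 0 \<le> d \<Longrightarrow> d < \<delta> \<Longrightarrow>
      (\<forall>i\<in>(I::'i set). 0 \<le> p i \<and> solves s T (\<xi> i) \<and> norm (\<xi> i s) \<le> R' \<and> norm (\<xi> i s - \<zeta> s) \<le> d) \<Longrightarrow> sum p I = 1 \<Longrightarrow>
      norm ((\<Sum>i\<in>I. p i *\<^sub>R \<psi> (\<xi> i T)) - \<psi> (\<zeta> T)) \<le> M * norm ((\<Sum>i\<in>I. p i *\<^sub>R \<xi> i s) - \<zeta> s) + \<epsilon>2 * d"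
    using aff[OF pos(2)] by blast
  obtain \<eta>1 where \<eta>1: "\<eta>1 > 0" and first: "\<And>s T x. solves s T x \<Longrightarrow> norm (x s) \<le> R \<Longrightarrow> T - s < \<eta>1 \<Longrightarrow>
    norm (x s + (T - s) *\<^sub>R v s (x s) - x T) \<le> \<epsilon>1 * (T - s)"
    using solves_first_order[OF pos(1) R] by blast
  \<comment> \<open>The three entries ensure the Euler estimate, the bound
    \<open>h * D < \<delta>\<close> and the bound \<open>h * C \<le> 1 / 2\<close>.\<close>
  define \<eta> where "\<eta> = min \<eta>1 (min (\<delta> / (D + 1)) (1 / (2 * C + 1)))"
  show ?thesis
  proof (intro exI[of _ \<eta>] conjI allI impI)
    show "\<eta> > 0" using \<eta>1 \<delta> D C by (auto simp: \<eta>_def)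
    fix s t T y assume st: "0 \<le> s" "s \<le> t" "t \<le> T" "T \<le> 1" and t: "t - s < \<eta>"
    define h where "h = t - s"
    have h: "0 \<le> h" "h \<le> 1" using st by (auto simp: h_def)
    define yi where "yi i = y + h *\<^sub>R u s i y" for i
    define \<zeta> where "\<zeta> r = flow s r y" for r
    define \<xi> where "\<xi> i r = flow t r (yi i)" for i r
    have \<zeta>: "\<zeta> s = y" "solves s T \<zeta>"
      unfolding \<zeta>_def using st by (auto intro: flow_solves solves_subinterval[OF flow_solves(2)])
    have \<xi>: "\<xi> i t = yi i" "solves t T (\<xi> i)" for i
      unfolding \<xi>_def using st by (auto intro: flow_solves solves_subinterval[OF flow_solves(2)])
    have u: "norm (u s i y) \<le> C * norm y + C" if "i \<in> I" for i
      using u_growth that st by auto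
    have "\<bar>(\<Sum>i\<in>I. p s i y * \<psi> (\<xi> i T)) - \<psi> (\<zeta> T)\<bar> \<le> \<epsilon> * h"
    proof (cases "norm y \<le> R")
      case y: True
      have \<zeta>': "solves s t \<zeta>" "solves t T \<zeta>"
        using st by (auto intro: solves_subinterval[OF \<zeta>(2)])
      have yi_y: "norm (yi i - y) \<le> h * D1" if "i \<in> I" for i
      proof -
        have "norm (u s i y) \<le> D1"
          using u[OF that] mult_left_mono[OF y C] by (simp add: D1_def)
        then show ?thesis using h by (simp add: yi_def mult_left_mono)
      qed
      have hD1: "h * D1 \<le> D1" using h D12 by (simp add: mult_left_le_one_le)
      have \<zeta>y: "norm (\<zeta> t - y) \<le> h * D2"
        using solves_displacement[OF \<zeta>'(1), of R] y \<zeta>(1) by (simp add: D2_def h_def)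
      have "norm (\<zeta> t) \<le> reach R"
        using solves_bound[OF \<zeta>'(1), of t] reach_mono[OF y] st \<zeta>(1) by simp
      then have \<zeta>R: "norm (\<zeta> t) \<le> R'" using R D12 by (simp add: R'_def)
      have yi: "norm (\<xi> i t) \<le> R'" "norm (\<xi> i t - \<zeta> t) \<le> h * D" if "i \<in> I" for i
      proof -
        show "norm (\<xi> i t) \<le> R'"
          using norm_triangle_sub[of "yi i" y] yi_y[OF that] hD1 y reachR by (simp add: \<xi>(1) R'_def)
        have "norm (yi i - \<zeta> t) \<le> norm (yi i - y) + norm (\<zeta> t - y)" by norm
        then show "norm (\<xi> i t - \<zeta> t) \<le> h * D"
          using yi_y[OF that] \<zeta>y by (simp add: \<xi>(1) D_def algebra_simps)
      qed
      have hD: "h * D < \<delta>"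
      proof -
        have "h * D \<le> h * (D + 1)" using h by (intro mult_left_mono) auto
        also have "h < \<delta> / (D + 1)" using t by (simp add: h_def \<eta>_def)
        then have "h * (D + 1) < \<delta>" using D by (simp add: field_simps)
        finally show ?thesis .
      qed
      have ps: "(\<Sum>i\<in>I. p s i y) = 1" using p_sum st by auto
      \<comment> \<open>Here it enters that \<open>v\<close> is the mean of the velocities
        \<open>u\<close>: the mean of the jump targets is the Euler step of
        \<open>v\<close>.\<close>
      have "(\<Sum>i\<in>I. p s i y *\<^sub>R \<xi> i t) = (\<Sum>i\<in>I. p s i y *\<^sub>R y) + h *\<^sub>R (\<Sum>i\<in>I. p s i y *\<^sub>R u s i y)"
        by (simp add: \<xi>(1) yi_def scaleR_add_right sum.distrib scaleR_sum_right mult_ac)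
      also have "\<dots> = y + h *\<^sub>R v s y"
        using v_eq[of s y] st ps by (simp flip: scaleR_left.sum)
      finally have bary: "(\<Sum>i\<in>I. p s i y *\<^sub>R \<xi> i t) = y + h *\<^sub>R v s y" .
      have "norm (y + h *\<^sub>R v s y - \<zeta> t) \<le> \<epsilon>1 * h"
        using first[OF \<zeta>'(1)] y t \<zeta>(1) by (simp add: h_def \<eta>_def)
      then have 1: "norm ((\<Sum>i\<in>I. p s i y *\<^sub>R \<xi> i t) - \<zeta> t) \<le> \<epsilon>1 * h"
        by (simp add: bary)
      have "norm ((\<Sum>i\<in>I. p s i y *\<^sub>R \<psi> (\<xi> i T)) - \<psi> (\<zeta> T)) \<le>
          M * norm ((\<Sum>i\<in>I. p s i y *\<^sub>R \<xi> i t) - \<zeta> t) + \<epsilon>2 * (h * D)"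
        using yi \<xi>(2) p_nonneg st h D by (intro aff'[OF \<zeta>'(2) \<zeta>R _ hD _ ps]) auto
      also have "\<dots> \<le> M * (\<epsilon>1 * h) + \<epsilon>2 * (h * D)"
        using 1 M by (intro add_right_mono mult_left_mono)
      also have "\<dots> = (M * \<epsilon>1 + \<epsilon>2 * D) * h" by (simp add: algebra_simps)
      also have "\<dots> \<le> \<epsilon> * h" using le h by (intro mult_right_mono)
      finally show ?thesis by simp
    next
      case y: False
      have far: "\<psi> (x T) = 0" if "solves r T x" "norm (x r) > reach R0" for x r
      proof (rule supp, rule ccontr)
        assume "\<not> norm (x T) > R0"
        then have "reach (norm (x T)) \<le> reach R0" by (intro reach_mono) simp
        with solves_bound_backward[OF that(1)] that(2) show False by linarith
      qed
      have "\<psi> (\<zeta> T) = 0"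
        using y reach0 \<zeta>(1) by (intro far[OF \<zeta>(2)]) (simp add: R_def)
      moreover have "\<psi> (\<xi> i T) = 0" if "i \<in> I" for i
      proof (rule far[OF \<xi>(2)])
        have "h * C \<le> 1 / 2"
        proof -
          have "h \<le> 1 / (2 * C + 1)" using t by (simp add: h_def \<eta>_def)
          then have "h * (2 * C + 1) \<le> 1" using C by (simp add: field_simps)
          then show ?thesis using h by (simp add: algebra_simps)
        qed
        then have "h * C * (norm y + 1) \<le> 1 / 2 * (norm y + 1)" by (intro mult_right_mono) auto
        moreover have "norm (h *\<^sub>R u s i y) \<le> h * (C * norm y + C)"
          using u[OF that] h by (simp add: mult_left_mono)
        moreover have "norm (yi i) \<ge> norm y - norm (h *\<^sub>R u s i y)"
          unfolding yi_def by (rule norm_diff_ineq)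
        moreover have "h * (C * norm y + C) = h * C * (norm y + 1)" by (simp add: algebra_simps)
        ultimately have "norm (yi i) \<ge> norm y - 1 / 2 * (norm y + 1)" by linarith
        moreover have "norm y > 2 * reach R0 + 1" using y by (simp add: R_def)
        then have "norm y - 1 / 2 * (norm y + 1) > reach R0" by (simp add: field_simps)
        ultimately show "norm (\<xi> i t) > reach R0" unfolding \<xi>(1) by (rule less_le_trans[rotated])
      qed
      ultimately show ?thesis using \<epsilon> h by simp
    qed
    then show "\<bar>(\<Sum>i\<in>I. p s i y * \<psi> (flow t T (y + (t - s) *\<^sub>R u s i y))) - \<psi> (flow s T y)\<bar> \<le> \<epsilon> * (t - s)"
      by (simp add: \<xi>_def \<zeta>_def yi_def h_def)
  qed
qed

lemma integral_flow:
  fixes \<psi> :: "'a \<Rightarrow> real"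
  assumes \<psi>: "cont_diff_in_space (\<lambda>_. \<psi>)" and supp: "\<And>x. norm x > R0 \<Longrightarrow> \<psi> x = 0" and R0: "R0 \<ge> 0"
    and range: "\<And>x. 0 \<le> \<psi> x \<and> \<psi> x \<le> 1" and T: "T \<in> {0..1}"
  shows "(\<integral>x. \<psi> (flow 0 T x) \<partial>\<mu> 0) = (\<integral>x. \<psi> x \<partial>\<mu> T)"
proof -
  have "continuous_on UNIV ((\<lambda>(t::real, x). \<psi> x) \<circ> (\<lambda>x. (0, x)))"
    using \<psi> unfolding cont_diff_in_space_def
    by (intro continuous_on_compose continuous_intros) (auto elim!: continuous_on_subset)
  then have \<psi>_cont: "continuous_on UNIV \<psi>" by (simp add: o_def)
  have g_cont: "continuous_on UNIV (\<lambda>x. \<psi> (flow s T x))" if "0 \<le> s" "s \<le> T" for s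
    using that T by (intro continuous_on_compose2[OF \<psi>_cont continuous_on_flow]) auto
  define F where "F s = (\<integral>x. \<psi> (flow s T x) \<partial>\<mu> s)" for s
  have increment: "\<exists>\<eta>>0. \<forall>s t. 0 \<le> s \<longrightarrow> s \<le> t \<longrightarrow> t \<le> T \<longrightarrow> t - s < \<eta> \<longrightarrow> \<bar>F t - F s\<bar> \<le> \<epsilon> * (t - s)"
    if \<epsilon>: "\<epsilon> > 0" for \<epsilon>
  proof -
    obtain \<eta> where \<eta>: "\<eta> > 0" and "\<forall>s t T y. 0 \<le> s \<longrightarrow> s \<le> t \<longrightarrow> t \<le> T \<longrightarrow> T \<le> 1 \<longrightarrow> t - s < \<eta> \<longrightarrow>
        \<bar>(\<Sum>i\<in>I. p s i y * \<psi> (flow t T (y + (t - s) *\<^sub>R u s i y))) - \<psi> (flow s T y)\<bar> \<le> \<epsilon> * (t - s)"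
      using one_step_estimate[OF \<psi> supp R0 \<epsilon>] by blast
    then have est: "\<bar>(\<Sum>i\<in>I. p s i y * \<psi> (flow t T (y + (t - s) *\<^sub>R u s i y))) - \<psi> (flow s T y)\<bar> \<le> \<epsilon> * (t - s)"
      if "0 \<le> s" "s \<le> t" "t \<le> T" "t - s < \<eta>" for s t y
      using that T by simp
    have "\<bar>F t - F s\<bar> \<le> \<epsilon> * (t - s)" if st: "0 \<le> s" "s \<le> t" "t \<le> T" "t - s < \<eta>" for s t
    proof -
      have s: "s \<in> {0..1}" using st T by auto
      interpret prob_space "\<mu> s" by (rule \<mu>_prob[OF s])
      define k where "k y = (\<Sum>i\<in>I. p s i y * \<psi> (flow t T (y + (t - s) *\<^sub>R u s i y)))" for y
      have meas_eq: "borel_measurable (\<mu> s) = borel_measurable borel"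
        using \<mu>_sets[OF s] by (rule measurable_cong_sets) simp
      have k_meas: "k \<in> borel_measurable (\<mu> s)"
        unfolding k_def meas_eq using st T s
        by (intro borel_measurable_sum borel_measurable_times p_meas
            measurable_compose[OF _ borel_measurable_continuous_onI[OF g_cont]]
            borel_measurable_add borel_measurable_scaleR u_meas) auto
      have "\<bar>k y\<bar> \<le> 1" for y
      proof -
        have "\<bar>k y\<bar> \<le> (\<Sum>i\<in>I. p s i y * 1)"
          unfolding k_def using p_nonneg[OF s] range
          by (intro order_trans[OF sum_abs] sum_mono) (auto simp: abs_mult intro!: mult_left_le)
        then show ?thesis using p_sum[OF s] by simp
      qed
      then have k_int: "integrable (\<mu> s) k"
        by (intro integrable_const_bound[where B = 1] k_meas) auto
      have g_int: "integrable (\<mu> s) (\<lambda>y. \<psi> (flow s T y))"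
        using st range by (intro integrable_const_bound[where B = 1])
          (auto simp: meas_eq intro!: borel_measurable_continuous_onI g_cont)
      \<comment> \<open>The one-step formula with the test function \<open>\<psi>\<close> composed
        with the flow from \<open>t\<close> to \<open>T\<close> moves the integral from
        \<open>\<mu> t\<close> to \<open>\<mu> s\<close>, so both values of \<open>F\<close> become
        integrals against one measure.\<close>
      have "F t = integral\<^sup>L (\<mu> s) k"
        unfolding F_def k_def using st T range by (intro step g_cont) auto
      then have "F t - F s = (\<integral>y. k y - \<psi> (flow s T y) \<partial>\<mu> s)"
        using k_int g_int by (simp add: F_def)
      also have "\<bar>\<dots>\<bar> \<le> (\<integral>y. \<bar>k y - \<psi> (flow s T y)\<bar> \<partial>\<mu> s)"
        by (rule integral_abs_bound)
      also have "\<dots> \<le> \<epsilon> * (t - s)"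
      proof (rule integral_le_const)
        show "integrable (\<mu> s) (\<lambda>y. \<bar>k y - \<psi> (flow s T y)\<bar>)" using k_int g_int by simp
      qed (use st est in \<open>auto simp: k_def\<close>)
      finally show ?thesis .
    qed
    with \<eta> show ?thesis by blast
  qed
  \<comment> \<open>The threshold in \<open>increment\<close> is uniform in both times, so
    exchanging their roles also handles difference quotients from the left.\<close>
  have "(F has_field_derivative 0) (at s within {0..T})" if s: "s \<in> {0..T}" for s
    unfolding has_field_derivative_def has_derivative_within_alt
  proof (intro conjI allI impI)
    fix \<epsilon> :: real assume "\<epsilon> > 0"
    from increment[OF this] obtain \<eta> where \<eta>: "\<eta> > 0"
      and inc: "\<And>s t. 0 \<le> s \<Longrightarrow> s \<le> t \<Longrightarrow> t \<le> T \<Longrightarrow> t - s < \<eta> \<Longrightarrow> \<bar>F t - F s\<bar> \<le> \<epsilon> * (t - s)" by blast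
    show "\<exists>d>0. \<forall>y\<in>{0..T}. norm (y - s) < d \<longrightarrow> norm (F y - F s - 0 * (y - s)) \<le> \<epsilon> * norm (y - s)"
    proof (intro exI[of _ \<eta>] conjI ballI impI \<eta>)
      fix y assume y: "y \<in> {0..T}" "norm (y - s) < \<eta>"
      then show "norm (F y - F s - 0 * (y - s)) \<le> \<epsilon> * norm (y - s)"
        using inc[of s y] inc[of y s] s by (cases "s \<le> y") auto
    qed
  qed (rule bounded_linear_mult_right)
  then obtain c where "\<And>s. s \<in> {0..T} \<Longrightarrow> F s = c"
    using has_field_derivative_zero_constant[of "{0..T}" F] by auto
  then have "F 0 = F T" using T by auto
  moreover have "flow T T x = x" for x using flow_solves(1)[of T x] T by auto
  ultimately show ?thesis by (simp add: F_def)
qed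

end

section \<open>Interpolation between a positive definite matrix and the identity\<close>

lemma matrix_inv_invertible:
  fixes M :: "real ^ 'n ^ 'n"
  assumes "invertible M"
  shows "M ** matrix_inv M = mat 1" "matrix_inv M ** M = mat 1"
  using someI_ex[of "\<lambda>A'. M ** A' = mat 1 \<and> A' ** M = mat 1"] assms
  by (auto simp: invertible_def matrix_inv_def)

lemma matrix_inv_vector:
  fixes M :: "real ^ 'n ^ 'n"
  assumes "invertible M"
  shows "M *v (matrix_inv M *v x) = x" "matrix_inv M *v (M *v x) = x"
  using matrix_inv_invertible[OF assms] by (simp_all add: matrix_vector_mul_assoc)

lemma interp_matrix_vector:
  "interp_matrix A t *v x = t *\<^sub>R (A *v x) + (1 - t) *\<^sub>R x"
  by (simp add: interp_matrix_def matrix_vector_mult_add_rdistrib scaleR_matrix_vector_assoc[symmetric])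

text \<open>The quadratic form of \<open>A\<close> attains a positive minimum on the unit sphere,
  convex combinations with the identity keep a lower bound, and Cauchy-Schwarz turns it into a bound
  on the vector. The constant is uniform in \<open>t\<close>.\<close>

lemma interp_matrix_coercive:
  fixes A :: "real ^ 'n ^ 'n"
  assumes "sym_pos_def A"
  obtains m where "m > 0" "\<And>t x. t \<in> {0..1} \<Longrightarrow> m * norm x \<le> norm (interp_matrix A t *v x)"
proof -
  have A: "0 < x \<bullet> (A *v x)" if "x \<noteq> 0" for x using assms that by (simp add: sym_pos_def_def)
  have "compact (sphere (0::real^'n) 1)" "sphere (0::real^'n) 1 \<noteq> {}" by auto
  moreover have "continuous_on (sphere (0::real^'n) 1) (\<lambda>x. x \<bullet> (A *v x))"
    by (intro continuous_intros matrix_vector_mult_linear_continuous_on)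
  ultimately obtain x0 :: "real ^ 'n" where x0: "norm x0 = 1"
    and min: "\<And>y. norm y = 1 \<Longrightarrow> x0 \<bullet> (A *v x0) \<le> y \<bullet> (A *v y)"
    using continuous_attains_inf[of "sphere (0::real^'n) 1" "\<lambda>x. x \<bullet> (A *v x)"] by auto
  \<comment> \<open>The cap at 1 makes \<open>m\<close> a lower bound for the form of the identity
    too.\<close>
  define m where "m = min 1 (x0 \<bullet> (A *v x0))"
  have "x0 \<noteq> 0" using x0 by auto
  then have m: "m > 0" using A[of x0] by (simp add: m_def)
  have coer: "m * (x \<bullet> x) \<le> x \<bullet> (A *v x)" for x :: "real ^ 'n"
  proof (cases "x = 0")
    case False
    define y where "y = inverse (norm x) *\<^sub>R x"
    have "norm y = 1" using False by (simp add: y_def)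
    then have "m \<le> y \<bullet> (A *v y)" using min[of y] by (simp add: m_def min_le_iff_disj)
    then have "norm x * (norm x * m) \<le> norm x * (norm x * (y \<bullet> (A *v y)))"
      by (intro mult_left_mono) auto
    also have "\<dots> = x \<bullet> (A *v x)"
      using False by (simp add: y_def matrix_vector_mult_scaleR field_simps)
    finally show ?thesis
      by (simp add: dot_square_norm power2_eq_square mult_ac)
  qed simp
  show thesis
  proof
    fix t :: real and x :: "real ^ 'n" assume t: "t \<in> {0..1}"
    have "m * (x \<bullet> x) \<le> t * (x \<bullet> (A *v x)) + (1 - t) * (x \<bullet> x)"
    proof -
      have "t * (m * (x \<bullet> x)) \<le> t * (x \<bullet> (A *v x))" using t coer by (intro mult_left_mono) auto
      moreover have "(1 - t) * (m * (x \<bullet> x)) \<le> (1 - t) * (1 * (x \<bullet> x))"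
        using t by (intro mult_left_mono mult_right_mono) (auto simp: m_def)
      ultimately show ?thesis by (simp add: algebra_simps)
    qed
    also have "\<dots> = x \<bullet> (interp_matrix A t *v x)"
      by (simp add: interp_matrix_vector inner_add_right)
    also have "\<dots> \<le> norm x * norm (interp_matrix A t *v x)" by (rule norm_cauchy_schwarz)
    finally have "norm x * (m * norm x) \<le> norm x * norm (interp_matrix A t *v x)"
      by (simp add: dot_square_norm power2_eq_square mult_ac)
    then show "m * norm x \<le> norm (interp_matrix A t *v x)"
      by (cases "x = 0") auto
  qed (rule m)
qed

lemma interp_matrix_invertible:
  fixes A :: "real ^ 'n ^ 'n"
  assumes "sym_pos_def A" "t \<in> {0..1}"
  shows "invertible (interp_matrix A t)"
proof -
  obtain m where m: "m > 0" "\<And>t x. t \<in> {0..1} \<Longrightarrow> m * norm x \<le> norm (interp_matrix A t *v x)"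
    by (rule interp_matrix_coercive[OF assms(1)]) (rule that)
  have "x = 0" if "interp_matrix A t *v x = 0" for x
    using m(2)[OF assms(2), of x] m(1) that by (auto simp: mult_le_0_iff)
  then show ?thesis
    unfolding invertible_left_inverse matrix_left_invertible_ker by blast
qed

text \<open>The inverse as a bounded linear map, so that continuity in \<open>t\<close> refers to
  the operator norm, as \<open>cont_diff_in_space_affine\<close> requires.\<close>

definition interp_inverse :: "real ^ 'n ^ 'n \<Rightarrow> real \<Rightarrow> (real ^ 'n) \<Rightarrow>\<^sub>L (real ^ 'n)" where
  "interp_inverse A t = Blinfun ((*v) (matrix_inv (interp_matrix A t)))"

lemma interp_inverse_apply: "blinfun_apply (interp_inverse A t) x = matrix_inv (interp_matrix A t) *v x"
  by (simp add: interp_inverse_def bounded_linear_Blinfun_apply)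

lemma interp_inverse_bound:
  fixes A :: "real ^ 'n ^ 'n"
  assumes "sym_pos_def A"
  obtains b where "b \<ge> 0" "\<And>t x. t \<in> {0..1} \<Longrightarrow> norm (interp_inverse A t x) \<le> b * norm x"
proof -
  obtain m where m: "m > 0" "\<And>t x. t \<in> {0..1} \<Longrightarrow> m * norm x \<le> norm (interp_matrix A t *v x)"
    by (rule interp_matrix_coercive[OF assms(1)]) (rule that)
  show thesis
  proof
    fix t :: real and x assume t: "t \<in> {0..1}"
    have "m * norm (interp_inverse A t x) \<le> norm x"
      using m(2)[OF t, of "interp_inverse A t x"] matrix_inv_vector(1)[OF interp_matrix_invertible[OF assms t]]
      by (simp add: interp_inverse_apply)
    then show "norm (interp_inverse A t x) \<le> inverse m * norm x"
      using m(1) by (simp add: field_simps)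
  qed (use m in auto)
qed

text \<open>In finite dimension continuity may be checked vector by vector. With \<open>B t\<close>
  for the inverse at time \<open>t\<close>, the resolvent identity
  \<open>B t - B s = (s - t) B t (A - 1) B s\<close> and the uniform bound on \<open>B\<close> give
  Lipschitz continuity in time.\<close>

lemma continuous_on_interp_inverse:
  fixes A :: "real ^ 'n ^ 'n"
  assumes "sym_pos_def A"
  shows "continuous_on {0..1} (interp_inverse A)"
proof (rule continuous_on_blinfun_componentwise)
  fix i :: "real ^ 'n"
  obtain b where b: "b \<ge> 0" "\<And>t x. t \<in> {0..1} \<Longrightarrow> norm (interp_inverse A t x) \<le> b * norm x"
    by (rule interp_inverse_bound[OF assms]) (rule that)
  have resolvent: "interp_inverse A t i - interp_inverse A s i =
      (s - t) *\<^sub>R interp_inverse A t (A *v interp_inverse A s i - interp_inverse A s i)"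
    if "t \<in> {0..1}" "s \<in> {0..1}" for s t
  proof -
    define z where "z = interp_inverse A s i"
    have i: "interp_matrix A s *v z = i"
      using matrix_inv_vector(1)[OF interp_matrix_invertible[OF assms that(2)]]
      by (simp add: z_def interp_inverse_apply)
    have "interp_inverse A t i - z = interp_inverse A t (i - interp_matrix A t *v z)"
      using matrix_inv_vector(2)[OF interp_matrix_invertible[OF assms that(1)]]
      by (simp add: interp_inverse_apply matrix_vector_mult_diff_distrib)
    also have "i - interp_matrix A t *v z = (s - t) *\<^sub>R (A *v z - z)"
      unfolding i[symmetric] by (simp add: interp_matrix_vector algebra_simps)
    finally show ?thesis by (simp add: z_def blinfun.scaleR_right)
  qed
  define L where "L = b * (onorm ((*v) A) * (b * norm i) + b * norm i)"
  have "L-lipschitz_on {0..1} (\<lambda>t. interp_inverse A t i)"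
  proof (rule lipschitz_onI)
    fix t s :: real assume t: "t \<in> {0..1}" and s: "s \<in> {0..1}"
    define z where "z = interp_inverse A s i"
    have z: "norm z \<le> b * norm i" unfolding z_def by (rule b(2)[OF s])
    have "norm (A *v z) \<le> onorm ((*v) A) * norm z"
      by (intro onorm matrix_vector_mul_bounded_linear)
    also have "\<dots> \<le> onorm ((*v) A) * (b * norm i)"
      using z by (intro mult_left_mono onorm_pos_le matrix_vector_mul_bounded_linear)
    finally have "norm (A *v z - z) \<le> onorm ((*v) A) * (b * norm i) + b * norm i"
      using z norm_triangle_ineq4[of "A *v z" z] by linarith
    then have "norm (interp_inverse A t (A *v z - z)) \<le> L"
      unfolding L_def using b(1) by (intro order_trans[OF b(2)[OF t]] mult_left_mono)
    then have "\<bar>s - t\<bar> * norm (interp_inverse A t (A *v z - z)) \<le> \<bar>s - t\<bar> * L"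
      by (intro mult_left_mono) auto
    then show "dist (interp_inverse A t i) (interp_inverse A s i) \<le> L * dist t s"
      using resolvent[OF t s] by (simp add: dist_norm z_def mult.commute abs_minus_commute)
  next
    show "0 \<le> L" unfolding L_def using b(1)
      by (intro mult_nonneg_nonneg add_nonneg_nonneg onorm_pos_le matrix_vector_mul_bounded_linear) auto
  qed
  then show "continuous_on {0..1} (\<lambda>t. interp_inverse A t i)"
    by (rule lipschitz_on_continuous_on)
qed

lemma continuous_on_det_interp_matrix: "continuous_on S (\<lambda>t. det (interp_matrix A t))"
  unfolding det_def interp_matrix_def
  by (auto intro!: continuous_intros)

section \<open>Regularity and growth of the component densities and velocities\<close>

lemma cont_diff_in_space_component_density:
  assumes "continuously_differentiable \<rho>" "sym_pos_def A"
  shows "cont_diff_in_space (component_density \<rho> A a)"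
proof -
  have det: "det (interp_matrix A t) \<noteq> 0" if "t \<in> {0..1}" for t
    using interp_matrix_invertible[OF assms(2) that] by (simp add: invertible_det_nz)
  have "cont_diff_in_space (\<lambda>t x. inverse \<bar>det (interp_matrix A t)\<bar> *
      \<rho> (blinfun_apply (interp_inverse A t) x + - blinfun_apply (interp_inverse A t) (t *\<^sub>R a)))"
    using det
    by (intro cont_diff_in_space_scaleR[where 'b = real, unfolded real_scaleR_def] cont_diff_in_space_time
        cont_diff_in_space_compose[OF assms(1)] cont_diff_in_space_affine continuous_on_interp_inverse[OF assms(2)]
        continuous_intros continuous_on_det_interp_matrix) auto
  then show ?thesis
    by (simp add: component_density_def[abs_def] affine_density_def[abs_def] interp_inverse_apply
        matrix_vector_mult_diff_distrib)
qed

text \<open>The vector \<open>z = interp_inverse A t (x - t *\<^sub>R a)\<close> is the starting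
  point of the line that passes through \<open>x\<close> at time \<open>t\<close>, and the velocity
  is the end point \<open>A *v z + a\<close> minus \<open>z\<close>.\<close>

lemma component_velocity_eq:
  "component_velocity A a t x = a + (A *v interp_inverse A t (x - t *\<^sub>R a) - interp_inverse A t (x - t *\<^sub>R a))"
  by (simp add: component_velocity_def interp_inverse_apply matrix_vector_mul_assoc[symmetric]
      matrix_vector_mult_diff_rdistrib)

lemma cont_diff_in_space_component_velocity:
  assumes "sym_pos_def A"
  shows "cont_diff_in_space (component_velocity A a)"
proof -
  define V where "V t = Blinfun ((*v) (A - mat 1)) o\<^sub>L interp_inverse A t" for t
  have "cont_diff_in_space (\<lambda>t x. blinfun_apply (V t) x + (a - blinfun_apply (V t) (t *\<^sub>R a)))"
    unfolding V_def
    by (intro cont_diff_in_space_affine continuous_intros continuous_on_interp_inverse[OF assms])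
  then show ?thesis
    by (simp add: component_velocity_def[abs_def] V_def interp_inverse_apply bounded_linear_Blinfun_apply
        matrix_vector_mul_assoc matrix_vector_mult_diff_distrib algebra_simps)
qed

lemma component_velocity_growth:
  assumes "sym_pos_def A"
  obtains C where "C \<ge> 0" "\<And>t x. t \<in> {0..1} \<Longrightarrow> norm (component_velocity A a t x) \<le> C * norm x + C"
proof -
  obtain b where b: "b \<ge> 0" "\<And>t x. t \<in> {0..1} \<Longrightarrow> norm (interp_inverse A t x) \<le> b * norm x"
    by (rule interp_inverse_bound[OF assms]) (rule that)
  define k where "k = (onorm ((*v) A) + 1) * b"
  have on: "onorm ((*v) A) \<ge> 0" by (intro onorm_pos_le matrix_vector_mul_bounded_linear)
  have k: "k \<ge> 0" unfolding k_def using b on by auto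
  show thesis
  proof
    \<comment> \<open>The maximum of slope and intercept, since the growth condition allows only one
      constant.\<close>
    show "0 \<le> max k (norm a + k * norm a)" using k by simp
    fix t :: real and x assume t: "t \<in> {0..1}"
    define z where "z = interp_inverse A t (x - t *\<^sub>R a)"
    have "norm (A *v z - z) \<le> norm (A *v z) + norm z" by (rule norm_triangle_ineq4)
    also have "norm (A *v z) \<le> onorm ((*v) A) * norm z"
      by (intro onorm matrix_vector_mul_bounded_linear)
    also have "onorm ((*v) A) * norm z + norm z = (onorm ((*v) A) + 1) * norm z" by (simp add: algebra_simps)
    also have "norm z \<le> b * norm (x - t *\<^sub>R a)" unfolding z_def by (rule b(2)[OF t])
    also have "norm (x - t *\<^sub>R a) \<le> norm x + norm a"
      using norm_triangle_ineq4[of x "t *\<^sub>R a"] t mult_left_le_one_le[of "norm a" t] by simp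
    finally have "norm (A *v z - z) \<le> k * (norm x + norm a)"
      using on b by (simp add: k_def mult_left_mono mult.assoc)
    then have "norm (component_velocity A a t x) \<le> k * norm x + (norm a + k * norm a)"
      unfolding component_velocity_eq z_def[symmetric]
      using norm_triangle_ineq[of a "A *v z - z"] by (simp add: algebra_simps)
    also have "\<dots> \<le> max k (norm a + k * norm a) * norm x + max k (norm a + k * norm a)"
      by (intro add_mono mult_right_mono) auto
    finally show "norm (component_velocity A a t x) \<le>
      max k (norm a + k * norm a) * norm x + max k (norm a + k * norm a)" .
  qed
qed

section \<open>Linear images of Lebesgue measure\<close>

text \<open>
  The library proves the effect of linear maps on Lebesgue measure only for well-ordered index types.
\<close>

lemma
  fixes M :: "real ^ 'n ^ 'n"
  assumes "det M \<noteq> 0" "S \<in> lmeasurable"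
  shows measurable_matrix_image: "(*v) M ` S \<in> lmeasurable"
    and measure_matrix_image: "measure lebesgue ((*v) M ` S) = \<bar>det M\<bar> * measure lebesgue S"
proof -
  \<comment> \<open>Restricted to nonsingular matrices, the claim passes to products because the
    determinant is multiplicative, and the elementary case of a zero row is void.\<close>
  let ?good = "\<lambda>M :: real ^ 'n ^ 'n. det M \<noteq> 0 \<longrightarrow> (\<forall>S\<in>lmeasurable. (*v) M ` S \<in> lmeasurable \<and>
      measure lebesgue ((*v) M ` S) = \<bar>det M\<bar> * measure lebesgue S)"
  \<comment> \<open>For determinant 1 or -1 it is enough to preserve the volume of boxes; this
    serves coordinate swaps and shears, while diagonal matrices are stretches.\<close>
  have cbox_suffices: "?good M"
    if "\<bar>det M\<bar> = 1" "\<And>a b. cbox a b \<noteq> {} \<Longrightarrow> measure lebesgue ((*v) M ` cbox a b) = measure lebesgue (cbox a b)"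
    for M :: "real ^ 'n ^ 'n"
  proof (intro impI ballI)
    fix S :: "(real ^ 'n) set" assume S: "S \<in> lmeasurable"
    have "measure lebesgue ((*v) M ` cbox a b) = 1 * measure lebesgue (cbox a b)" for a b
      using that(2)[of a b] by (cases "cbox a b = {}") auto
    from measure_linear_sufficient[OF matrix_vector_mul_linear S this]
    show "(*v) M ` S \<in> lmeasurable \<and> measure lebesgue ((*v) M ` S) = \<bar>det M\<bar> * measure lebesgue S"
      using that(1) by simp
  qed
  have "?good M"
  proof (rule induct_matrix_elementary_alt)
    fix A B :: "real ^ 'n ^ 'n" assume A: "?good A" and B: "?good B"
    show "?good (A ** B)"
    proof (intro impI ballI)
      fix S :: "(real ^ 'n) set" assume "det (A ** B) \<noteq> 0" and S: "S \<in> lmeasurable"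
      then have nz: "det A \<noteq> 0" "det B \<noteq> 0" by (auto simp: det_mul)
      have "(*v) (A ** B) ` S = (*v) A ` (*v) B ` S"
        by (simp add: image_image matrix_vector_mul_assoc)
      moreover have "(*v) B ` S \<in> lmeasurable" using B nz S by blast
      ultimately show "(*v) (A ** B) ` S \<in> lmeasurable \<and>
          measure lebesgue ((*v) (A ** B) ` S) = \<bar>det (A ** B)\<bar> * measure lebesgue S"
        using A B nz S by (simp add: det_mul abs_mult)
    qed
  next
    fix A :: "real ^ 'n ^ 'n" and i assume "row i A = 0"
    then show "?good A" using det_zero_row(2) by blast
  next
    fix A :: "real ^ 'n ^ 'n" assume diag: "\<And>i j. i \<noteq> j \<Longrightarrow> A $ i $ j = 0"
    have "(*v) A = (\<lambda>x. \<chi> k. A $ k $ k * x $ k)"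
    proof
      fix x
      have "(\<Sum>j\<in>UNIV. A $ i $ j * x $ j) = (\<Sum>j\<in>UNIV. if j = i then A $ i $ i * x $ i else 0)" for i
        by (rule sum.cong) (auto simp: diag)
      then show "A *v x = (\<chi> k. A $ k $ k * x $ k)"
        by (simp add: matrix_vector_mult_def vec_eq_iff)
    qed
    then show "?good A"
      using det_diagonal[OF diag] by (simp add: measurable_stretch measure_stretch)
  next
    fix m n :: 'n assume "m \<noteq> n"
    let ?\<pi> = "Transposition.transpose m n"
    let ?P = "(\<chi> i j. mat 1 $ i $ ?\<pi> j) :: real ^ 'n ^ 'n"
    have P: "?P *v x = (\<chi> i. x $ ?\<pi> i)" for x
    proof -
      have "(\<Sum>j\<in>UNIV. mat 1 $ i $ ?\<pi> j * x $ j) = (\<Sum>j\<in>UNIV. if j = ?\<pi> i then x $ ?\<pi> i else 0)" for i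
        by (rule sum.cong) (auto simp: mat_def)
      then show ?thesis by (simp add: matrix_vector_mult_def vec_eq_iff)
    qed
    show "?good ?P"
    proof (rule cbox_suffices)
      show "\<bar>det ?P\<bar> = 1"
        by (simp add: det_permute_columns permutes_swap_id sign_swap_id abs_mult \<open>m \<noteq> n\<close>)
      fix a b :: "real ^ 'n" assume ne: "cbox a b \<noteq> {}"
      have img: "(*v) ?P ` cbox a b = cbox (?P *v a) (?P *v b)"
      proof (intro set_eqI iffI)
        fix x assume "x \<in> cbox (?P *v a) (?P *v b)"
        then have "a $ i \<le> x $ ?\<pi> i \<and> x $ ?\<pi> i \<le> b $ i" for i
          unfolding P mem_box_cart by (auto dest: spec[of _ "?\<pi> i"])
        then have "?P *v x \<in> cbox a b" unfolding P by (simp add: mem_box_cart)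
        moreover have "x = ?P *v (?P *v x)" unfolding P by (simp add: vec_eq_iff)
        ultimately show "x \<in> (*v) ?P ` cbox a b" by (rule image_eqI[rotated])
      qed (auto simp: P mem_box_cart)
      then have "cbox (?P *v a) (?P *v b) \<noteq> {}" using ne by (metis image_is_empty)
      then have "measure lebesgue (cbox (?P *v a) (?P *v b)) = (\<Prod>i\<in>UNIV. (?P *v b) $ i - (?P *v a) $ i)"
        by (simp add: content_cbox_cart)
      also have "\<dots> = (\<Prod>i\<in>UNIV. (b - a) $ ?\<pi> i)" unfolding P by simp
      also have "\<dots> = (\<Prod>i\<in>UNIV. (b - a) $ i)"
        by (intro prod.reindex_bij_betw) (simp add: bij_betw_def)
      also have "\<dots> = measure lebesgue (cbox a b)" using ne by (simp add: content_cbox_cart)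
      finally show "measure lebesgue ((*v) ?P ` cbox a b) = measure lebesgue (cbox a b)"
        by (simp only: img)
    qed
  next
    fix m n :: 'n assume mn: "m \<noteq> n"
    let ?E = "(\<chi> i j. of_bool (i = m \<and> j = n \<or> i = j)) :: real ^ 'n ^ 'n"
    have E: "?E *v x = (\<chi> i. if i = m then x $ m + x $ n else x $ i)" for x
    proof -
      have "(\<Sum>j\<in>UNIV. ?E $ i $ j * x $ j) =
          (\<Sum>j\<in>UNIV. (if j = i then x $ i else 0) + (if j = n then of_bool (i = m) * x $ n else 0))" for i
        using mn by (intro sum.cong) auto
      then show ?thesis by (auto simp: matrix_vector_mult_def vec_eq_iff sum.distrib)
    qed
    show "?good ?E"
    proof (rule cbox_suffices)
      have "?E = (\<chi> k. if k = m then row m (mat 1) + 1 *s row n (mat 1) else row k (mat 1))"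
        using mn by (auto simp: vec_eq_iff row_def mat_def)
      then show "\<bar>det ?E\<bar> = 1"
        using det_row_operation[OF mn, of "mat 1 :: real ^ 'n ^ 'n" 1] by simp
      fix a b :: "real ^ 'n" assume ne: "cbox a b \<noteq> {}"
      \<comment> \<open>The volume formula for sheared boxes requires a nonnegative lower corner in
        coordinate \<open>n\<close>; this translation moves it to 0, and translations preserve
        volume before and after the shear.\<close>
      define c where "c = axis n (- a $ n)"
      have "measure lebesgue ((*v) ?E ` cbox a b) = measure lebesgue ((+) (?E *v c) ` (*v) ?E ` cbox a b)"
        by (rule measure_translation[symmetric])
      also have "(+) (?E *v c) ` (*v) ?E ` cbox a b = (*v) ?E ` cbox (c + a) (c + b)"
        by (simp add: cbox_translation image_image matrix_vector_right_distrib)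
      also have "measure lebesgue \<dots> = measure lebesgue (cbox (c + a) (c + b))"
        unfolding E[abs_def]
        by (rule measure_shear_interval[OF mn]) (use ne in \<open>auto simp: cbox_translation c_def\<close>)
      also have "\<dots> = measure lebesgue (cbox a b)"
        unfolding cbox_translation by (rule measure_translation)
      finally show "measure lebesgue ((*v) ?E ` cbox a b) = measure lebesgue (cbox a b)" .
    qed
  qed
  with assms show "(*v) M ` S \<in> lmeasurable"
    "measure lebesgue ((*v) M ` S) = \<bar>det M\<bar> * measure lebesgue S" by blast+
qed

text \<open>The preimage of a box is the image of a translated box under
  \<open>matrix_inv M\<close>, and the density cancels the determinant of that inverse. The
  orientation of the equation permits replacing \<open>lborel\<close> under an integral, which is
  the substitution \<open>y = M *v x + b\<close>.\<close>

lemma lborel_affine_image: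
  fixes M :: "real ^ 'n ^ 'n"
  assumes M: "invertible M"
  shows "lborel = distr (density lborel (\<lambda>_. ennreal \<bar>det M\<bar>)) borel (\<lambda>x. M *v x + b)"
proof (rule lborel_eqI)
  have det: "det M \<noteq> 0" using M by (simp add: invertible_det_nz)
  have meas: "(\<lambda>x. M *v x + b) \<in> borel \<rightarrow>\<^sub>M borel"
    by (intro borel_measurable_continuous_onI continuous_intros matrix_vector_mult_linear_continuous_on)
  have detinv: "\<bar>det M\<bar> * \<bar>det (matrix_inv M)\<bar> = 1"
    using matrix_inv_invertible(1)[OF M] by (metis abs_1 abs_mult det_I det_mul)
  fix l u :: "real ^ 'n" assume le: "\<And>b. b \<in> Basis \<Longrightarrow> l \<bullet> b \<le> u \<bullet> b"
  define S where "S = (\<lambda>x. x - b) ` box l u"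
  have S: "S \<in> lmeasurable" unfolding S_def by (intro measurable_translation_subtract lmeasurable_box)
  have vimage: "(\<lambda>x. M *v x + b) -` box l u = (*v) (matrix_inv M) ` S"
  proof (intro set_eqI iffI)
    fix x assume "x \<in> (\<lambda>x. M *v x + b) -` box l u"
    then have "M *v x \<in> S" unfolding S_def by (auto intro: image_eqI[where x = "M *v x + b"])
    then show "x \<in> (*v) (matrix_inv M) ` S"
      by (intro image_eqI[where x = "M *v x"]) (simp_all add: matrix_inv_vector[OF M])
  qed (auto simp: S_def matrix_inv_vector[OF M])
  have sets: "(\<lambda>x. M *v x + b) -` box l u \<in> sets borel"
    using measurable_sets[OF meas, of "box l u"] by simp
  have dnz: "det (matrix_inv M) \<noteq> 0" using detinv by auto
  note lm = measurable_matrix_image[OF dnz S]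
  have "emeasure lborel ((\<lambda>x. M *v x + b) -` box l u) = emeasure lebesgue ((*v) (matrix_inv M) ` S)"
    using sets by (simp flip: vimage)
  also have "\<dots> = ennreal (measure lebesgue ((*v) (matrix_inv M) ` S))"
    using lm by (simp add: emeasure_eq_measure2 fmeasurableD2)
  also have "measure lebesgue ((*v) (matrix_inv M) ` S) = \<bar>det (matrix_inv M)\<bar> * measure lebesgue (box l u)"
    by (simp add: measure_matrix_image[OF dnz S]) (simp add: S_def measure_translation_subtract)
  finally have em: "emeasure lborel ((\<lambda>x. M *v x + b) -` box l u) =
      ennreal (\<bar>det (matrix_inv M)\<bar> * measure lebesgue (box l u))" .
  have "emeasure (distr (density lborel (\<lambda>_. ennreal \<bar>det M\<bar>)) borel (\<lambda>x. M *v x + b)) (box l u) =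
      ennreal \<bar>det M\<bar> * emeasure lborel ((\<lambda>x. M *v x + b) -` box l u)"
    using meas sets by (subst emeasure_distr) (auto simp: emeasure_density nn_integral_cmult_indicator)
  also have "\<dots> = ennreal (measure lebesgue (box l u))"
    unfolding em using detinv by (simp flip: ennreal_mult' mult.assoc)
  also have "\<dots> = ennreal (\<Prod>b\<in>Basis. (u - l) \<bullet> b)"
    using le by (simp add: measure_lborel_box_eq)
  finally show "emeasure (distr (density lborel (\<lambda>_. ennreal \<bar>det M\<bar>)) borel (\<lambda>x. M *v x + b)) (box l u) =
      ennreal (\<Prod>b\<in>Basis. (u - l) \<bullet> b)" .
qed simp

text \<open>Change of variables: the Jacobian \<open>\<bar>det M\<bar>\<close> cancels the prefactor
  in \<open>affine_density\<close>, which is therefore the density of the affine image of a variable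
  with density \<open>\<rho>\<close>.\<close>

lemma distribution_affine_density:
  fixes M :: "real ^ 'n ^ 'n"
  assumes M: "invertible M" and \<rho>: "\<rho> \<in> borel_measurable borel"
  shows "distribution (affine_density \<rho> M b) = distr (distribution \<rho>) borel (\<lambda>x. M *v x + b)"
proof (rule measure_eqI)
  have meas: "(\<lambda>x. M *v x + b) \<in> borel \<rightarrow>\<^sub>M borel"
    by (intro borel_measurable_continuous_onI continuous_intros matrix_vector_mult_linear_continuous_on)
  have minv: "(\<lambda>x. matrix_inv M *v (x - b)) \<in> borel \<rightarrow>\<^sub>M borel"
    by (intro borel_measurable_continuous_onI continuous_intros
        continuous_on_compose2[OF matrix_vector_mult_linear_continuous_on[of UNIV]]) auto
  have aff: "affine_density \<rho> M b \<in> borel_measurable borel"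
    unfolding affine_density_def[abs_def] using measurable_compose[OF minv \<rho>] by simp
  have det: "det M \<noteq> 0" using M by (simp add: invertible_det_nz)
  fix S assume "S \<in> sets (distribution (affine_density \<rho> M b))"
  then have S: "S \<in> sets borel" by (simp add: distribution_def)
  have "emeasure (distribution (affine_density \<rho> M b)) S =
      (\<integral>\<^sup>+y. ennreal (affine_density \<rho> M b y) * indicator S y \<partial>lborel)"
    unfolding distribution_def using S aff by (simp add: emeasure_density)
  also have "\<dots> = (\<integral>\<^sup>+x. ennreal \<bar>det M\<bar> *
      (ennreal (affine_density \<rho> M b (M *v x + b)) * indicator S (M *v x + b)) \<partial>lborel)"
    using aff meas S by (subst lborel_affine_image[OF M, of b])
      (simp add: nn_integral_distr nn_integral_density)
  also have "\<dots> = (\<integral>\<^sup>+x. ennreal (\<rho> x) * indicator ((\<lambda>x. M *v x + b) -` S) x \<partial>lborel)"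
    using det by (intro nn_integral_cong)
      (simp add: affine_density_def matrix_inv_vector[OF M] indicator_def flip: ennreal_mult' mult.assoc)
  also have "\<dots> = emeasure (distr (distribution \<rho>) borel (\<lambda>x. M *v x + b)) S"
    unfolding distribution_def using meas S \<rho> measurable_sets[OF meas S]
    by (subst emeasure_distr) (auto simp: emeasure_density)
  finally show "emeasure (distribution (affine_density \<rho> M b)) S =
      emeasure (distr (distribution \<rho>) borel (\<lambda>x. M *v x + b)) S" .
qed (simp add: distribution_def)

section \<open>Mixtures of affine images\<close>

lemma component_velocity_at_image:
  assumes A: "sym_pos_def A" and t: "t \<in> {0..1}"
  shows "component_velocity A a t (interp_matrix A t *v x + t *\<^sub>R a) = A *v x + a - x"
  by (simp add: component_velocity_eq interp_inverse_apply matrix_inv_vector[OF interp_matrix_invertible[OF A t]])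

text \<open>The velocity is constant along each path, so an Euler step of any length stays on it.
  This exactness yields the assumption \<open>step\<close> of locale
  \<open>superposition\<close>.\<close>

lemma component_path_step:
  assumes A: "sym_pos_def A" and s: "s \<in> {0..1}"
  shows "(interp_matrix A s *v x + s *\<^sub>R a) + (t - s) *\<^sub>R component_velocity A a s (interp_matrix A s *v x + s *\<^sub>R a) =
    interp_matrix A t *v x + t *\<^sub>R a"
  unfolding component_velocity_at_image[OF A s] by (simp add: interp_matrix_vector algebra_simps)

locale affine_mixture =
  fixes \<rho> :: "real ^ 'n \<Rightarrow> real" and J :: nat and w :: "nat \<Rightarrow> real"
    and a :: "nat \<Rightarrow> real ^ 'n" and A :: "nat \<Rightarrow> real ^ 'n ^ 'n"
  assumes \<rho>_C1: "continuously_differentiable \<rho>"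
    and \<rho>_pos: "\<And>x. 0 < \<rho> x"
    and \<rho>_int: "has_bochner_integral lborel \<rho> 1"
    and A: "\<And>j. j \<in> {1..J} \<Longrightarrow> sym_pos_def (A j)"
    and w: "\<And>j. j \<in> {1..J} \<Longrightarrow> 0 \<le> w j"
    and w_sum: "(\<Sum>j = 1..J. w j) = 1"
begin

abbreviation "cden j \<equiv> component_density \<rho> (A j) (a j)"
abbreviation "mix \<equiv> mixture_density \<rho> J w a A"
abbreviation "vel \<equiv> mixture_velocity \<rho> J w a A"

text \<open>The posterior probability of component \<open>j\<close>, given the position
  \<open>x\<close> at time \<open>t\<close>.\<close>

definition share :: "real \<Rightarrow> nat \<Rightarrow> real ^ 'n \<Rightarrow> real" where
  "share t j x = w j * cden j t x / mix t x"

section \<open>Positivity, regularity and weights of the mixture\<close>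

lemma \<rho>_meas: "\<rho> \<in> borel_measurable borel"
proof -
  have "continuous_on UNIV \<rho>"
    using \<rho>_C1 unfolding continuously_differentiable_def
    by (meson continuous_at_imp_continuous_on has_derivative_continuous)
  then show ?thesis by (rule borel_measurable_continuous_onI)
qed

lemma prob_space_ref: "prob_space (distribution \<rho>)"
proof (rule prob_spaceI)
  have "(\<integral>\<^sup>+x. ennreal (\<rho> x) \<partial>lborel) = 1"
    using \<rho>_int \<rho>_pos
    by (subst nn_integral_eq_integral) (auto simp: has_bochner_integral_iff less_imp_le)
  then show "emeasure (distribution \<rho>) (space (distribution \<rho>)) = 1"
    using \<rho>_meas by (simp add: distribution_def emeasure_density)
qed

lemma comp_pos: "j \<in> {1..J} \<Longrightarrow> t \<in> {0..1} \<Longrightarrow> cden j t x > 0"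
  using interp_matrix_invertible[OF A, of j t] \<rho>_pos
  by (simp add: component_density_def affine_density_def invertible_det_nz)

lemma mix_pos:
  assumes t: "t \<in> {0..1}"
  shows "mix t x > 0"
proof -
  \<comment> \<open>Nonnegative weights with sum 1 cannot all vanish; a single positive one makes
    the mixture positive everywhere.\<close>
  obtain j where j: "j \<in> {1..J}" "w j > 0"
    using w w_sum sum_nonpos[of "{1..J}" w] by (force simp: not_less)
  have "0 < w j * cden j t x" using j comp_pos[OF j(1) t] by simp
  also have "\<dots> \<le> mix t x"
    unfolding mixture_density_def using w comp_pos t
    by (intro member_le_sum[OF j(1)] mult_nonneg_nonneg) (auto intro: less_imp_le)
  finally show ?thesis .
qed

lemma comp_C1: "j \<in> {1..J} \<Longrightarrow> cont_diff_in_space (cden j)"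
  by (intro cont_diff_in_space_component_density \<rho>_C1 A)

lemma mix_C1: "cont_diff_in_space mix"
  unfolding mixture_density_def[abs_def]
  by (intro cont_diff_in_space_sum cont_diff_in_space_scaleR[where 'b = real, unfolded real_scaleR_def]
      cont_diff_in_space_time comp_C1 continuous_intros)

lemma vel_C1: "cont_diff_in_space vel"
  unfolding mixture_velocity_def[abs_def]
  by (intro cont_diff_in_space_sum cont_diff_in_space_scaleR cont_diff_in_space_inverse mix_C1
      cont_diff_in_space_scaleR[where 'b = real, unfolded real_scaleR_def] cont_diff_in_space_time comp_C1
      continuous_intros cont_diff_in_space_component_velocity A)
    (use mix_pos in \<open>auto simp: less_imp_neq[symmetric]\<close>)

lemma cont_diff_in_space_measurable:
  assumes "cont_diff_in_space f" "t \<in> {0..1}"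
  shows "f t \<in> borel_measurable borel"
proof -
  have "continuous_on UNIV ((\<lambda>(t, x). f t x) \<circ> (\<lambda>x. (t, x)))"
    using assms unfolding cont_diff_in_space_def
    by (intro continuous_on_compose continuous_intros) (auto elim!: continuous_on_subset)
  then show ?thesis by (intro borel_measurable_continuous_onI) (simp add: o_def)
qed

lemma share_nonneg: "j \<in> {1..J} \<Longrightarrow> t \<in> {0..1} \<Longrightarrow> 0 \<le> share t j x"
  unfolding share_def using w comp_pos mix_pos by (simp add: less_imp_le)

lemma share_sum: "t \<in> {0..1} \<Longrightarrow> (\<Sum>j = 1..J. share t j x) = 1"
  using mix_pos[of t x] unfolding share_def sum_divide_distrib[symmetric]
  by (simp add: mixture_density_def)

lemma vel_eq: "vel t x = (\<Sum>j = 1..J. share t j x *\<^sub>R component_velocity (A j) (a j) t x)"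
  by (simp add: mixture_velocity_def share_def scaleR_sum_right divide_inverse mult_ac)

lemma integral_comp:
  fixes f :: "real ^ 'n \<Rightarrow> real"
  assumes j: "j \<in> {1..J}" and t: "t \<in> {0..1}" and f: "f \<in> borel_measurable borel" "\<And>x. \<bar>f x\<bar> \<le> B"
  shows "integrable lborel (\<lambda>x. cden j t x * f x)"
    and "(\<integral>x. cden j t x * f x \<partial>lborel) = (\<integral>x. f (interp_matrix (A j) t *v x + t *\<^sub>R a j) \<partial>distribution \<rho>)"
proof -
  have meas: "(\<lambda>x. interp_matrix (A j) t *v x + t *\<^sub>R a j) \<in> borel \<rightarrow>\<^sub>M borel"
    by (intro borel_measurable_continuous_onI continuous_intros matrix_vector_mult_linear_continuous_on)
  have meas': "(\<lambda>x. interp_matrix (A j) t *v x + t *\<^sub>R a j) \<in> distribution \<rho> \<rightarrow>\<^sub>M borel"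
    using meas by (simp add: distribution_def)
  have D: "distribution (cden j t) = distr (distribution \<rho>) borel (\<lambda>x. interp_matrix (A j) t *v x + t *\<^sub>R a j)"
    unfolding component_density_def
    by (intro distribution_affine_density interp_matrix_invertible A j t \<rho>_meas)
  have comp_meas: "cden j t \<in> borel_measurable borel"
    by (rule cont_diff_in_space_measurable[OF comp_C1[OF j] t])
  have prob: "prob_space (distribution (cden j t))"
    unfolding D by (intro prob_space.prob_space_distr[OF prob_space_ref] meas')
  have nn: "0 \<le> cden j t x" for x using comp_pos[OF j t] by (simp add: less_imp_le)
  interpret P: prob_space "distribution (cden j t)" by (rule prob)
  have "integrable (distribution (cden j t)) f"
    using f by (intro P.integrable_const_bound[where B = B]) (auto simp: distribution_def)
  then show "integrable lborel (\<lambda>x. cden j t x * f x)"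
    unfolding distribution_def using f(1) comp_meas nn by (simp add: integrable_density)
  have "(\<integral>x. cden j t x * f x \<partial>lborel) = (\<integral>x. f x \<partial>distribution (cden j t))"
    unfolding distribution_def using f(1) comp_meas nn by (simp add: integral_density)
  also have "\<dots> = (\<integral>x. f (interp_matrix (A j) t *v x + t *\<^sub>R a j) \<partial>distribution \<rho>)"
    unfolding D using f(1) meas' by (simp add: integral_distr)
  finally show "(\<integral>x. cden j t x * f x \<partial>lborel) = (\<integral>x. f (interp_matrix (A j) t *v x + t *\<^sub>R a j) \<partial>distribution \<rho>)" .
qed

text \<open>The mixture density cancels the denominators of the posterior weights, leaving one
  integral per component, which is pulled back to the reference law. The integrand may depend on
  \<open>j\<close>, as it does when each component moves with its own velocity.\<close>

lemma integral_mix_sum: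
  fixes f :: "nat \<Rightarrow> real ^ 'n \<Rightarrow> real"
  assumes t: "t \<in> {0..1}" and f: "\<And>j. j \<in> {1..J} \<Longrightarrow> f j \<in> borel_measurable borel" "\<And>j x. j \<in> {1..J} \<Longrightarrow> \<bar>f j x\<bar> \<le> B"
  shows "(\<integral>x. (\<Sum>j = 1..J. share t j x * f j x) \<partial>distribution (mix t)) =
    (\<Sum>j = 1..J. w j * (\<integral>x. f j (interp_matrix (A j) t *v x + t *\<^sub>R a j) \<partial>distribution \<rho>))"
proof -
  have mix_meas: "mix t \<in> borel_measurable borel"
    by (rule cont_diff_in_space_measurable[OF mix_C1 t])
  have comp_meas: "cden j t \<in> borel_measurable borel" if "j \<in> {1..J}" for j
    by (rule cont_diff_in_space_measurable[OF comp_C1[OF that] t])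
  have meas: "(\<lambda>x. \<Sum>j = 1..J. share t j x * f j x) \<in> borel_measurable borel"
    unfolding share_def using comp_meas mix_meas f(1)
    by (intro borel_measurable_sum borel_measurable_times borel_measurable_divide) auto
  have "(\<integral>x. (\<Sum>j = 1..J. share t j x * f j x) \<partial>distribution (mix t)) =
      (\<integral>x. mix t x * (\<Sum>j = 1..J. share t j x * f j x) \<partial>lborel)"
    unfolding distribution_def using meas mix_meas mix_pos[OF t]
    by (subst integral_density) (auto simp: less_imp_le)
  also have "\<dots> = (\<integral>x. (\<Sum>j = 1..J. w j * (cden j t x * f j x)) \<partial>lborel)"
    using mix_pos[OF t] unfolding share_def sum_distrib_left
    by (intro Bochner_Integration.integral_cong refl sum.cong) (auto simp: less_imp_neq[symmetric])
  also have "\<dots> = (\<Sum>j = 1..J. (\<integral>x. w j * (cden j t x * f j x) \<partial>lborel))"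
    using integral_comp(1)[OF _ t f] by (intro Bochner_Integration.integral_sum integrable_mult_right) auto
  also have "\<dots> = (\<Sum>j = 1..J. w j * (\<integral>x. f j (interp_matrix (A j) t *v x + t *\<^sub>R a j) \<partial>distribution \<rho>))"
    using integral_comp(2)[OF _ t f] by (intro sum.cong) auto
  finally show ?thesis .
qed

lemma integral_mix:
  fixes f :: "real ^ 'n \<Rightarrow> real"
  assumes t: "t \<in> {0..1}" and f: "f \<in> borel_measurable borel" "\<And>x. \<bar>f x\<bar> \<le> B"
  shows "(\<integral>x. f x \<partial>distribution (mix t)) =
    (\<Sum>j = 1..J. w j * (\<integral>x. f (interp_matrix (A j) t *v x + t *\<^sub>R a j) \<partial>distribution \<rho>))"
  using integral_mix_sum[OF t, of "\<lambda>_. f" B] f share_sum[OF t]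
  by (simp flip: sum_distrib_right)

lemma prob_space_mix:
  assumes t: "t \<in> {0..1}"
  shows "prob_space (distribution (mix t))"
proof (rule prob_spaceI)
  interpret P: prob_space "distribution \<rho>" by (rule prob_space_ref)
  have mix_meas: "mix t \<in> borel_measurable borel"
    by (rule cont_diff_in_space_measurable[OF mix_C1 t])
  have int: "integrable lborel (\<lambda>x. \<Sum>j = 1..J. w j * (cden j t x * 1))"
    using integral_comp(1)[OF _ t, of _ "\<lambda>_. 1" 1]
    by (intro Bochner_Integration.integrable_sum integrable_mult_right) auto
  then have "integrable lborel (mix t)" by (simp add: mixture_density_def[abs_def])
  moreover have "(\<integral>x. mix t x \<partial>lborel) = (\<integral>x. 1 \<partial>distribution (mix t))"
    unfolding distribution_def using mix_meas mix_pos[OF t] by (subst integral_density) (auto simp: less_imp_le)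
  \<comment> \<open>The total mass is the integral of 1, and \<open>integral_mix\<close> evaluates
    it without presupposing a probability measure.\<close>
  moreover have "(\<integral>x. 1 \<partial>distribution (mix t)) = (1::real)"
    using integral_mix[OF t, of "\<lambda>_. 1" 1] w_sum by (simp add: P.prob_space)
  ultimately have "(\<integral>\<^sup>+x. ennreal (mix t x) \<partial>lborel) = 1"
    using mix_pos[OF t] by (subst nn_integral_eq_integral) (auto simp: less_imp_le)
  then show "emeasure (distribution (mix t)) (space (distribution (mix t))) = 1"
    using mix_meas by (simp add: distribution_def emeasure_density)
qed

lemma obtains_superposition:
  obtains C where "superposition vel C {1..J} share (\<lambda>t j. component_velocity (A j) (a j) t) (\<lambda>t. distribution (mix t))"
proof -
  have "\<forall>j\<in>{1..J}. \<exists>C\<ge>0. \<forall>t\<in>{0..1}. \<forall>x. norm (component_velocity (A j) (a j) t x) \<le> C * norm x + C"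
    using component_velocity_growth[OF A] by metis
  then obtain c where c: "\<And>j. j \<in> {1..J} \<Longrightarrow> c j \<ge> 0"
    "\<And>j t x. j \<in> {1..J} \<Longrightarrow> t \<in> {0..1} \<Longrightarrow> norm (component_velocity (A j) (a j) t x) \<le> c j * norm x + c j"
    by metis
  define C where "C = sum c {1..J}"
  have C: "C \<ge> 0" unfolding C_def using c(1) by (rule sum_nonneg)
  have u: "norm (component_velocity (A j) (a j) t x) \<le> C * norm x + C" if "j \<in> {1..J}" "t \<in> {0..1}" for j t x
  proof -
    have "c j \<le> C" unfolding C_def using that c(1) by (intro member_le_sum) auto
    then have "c j * norm x + c j \<le> C * norm x + C" by (intro add_mono mult_right_mono) auto
    then show ?thesis using c(2)[OF that, of x] by linarith
  qed
  show thesis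
  proof (rule that, intro superposition.intro flow_field.intro superposition_axioms.intro)
    show "cont_diff_in_space vel" by (rule vel_C1)
    show "0 \<le> C" by (rule C)
    show "norm (vel t x) \<le> C * norm x + C" if t: "t \<in> {0..1}" for t x
    proof -
      have "norm (vel t x) \<le> (\<Sum>j = 1..J. share t j x * (C * norm x + C))"
        unfolding vel_eq using share_nonneg[OF _ t] u[OF _ t]
        by (intro sum_norm_le) (auto intro!: mult_left_mono)
      then show ?thesis using share_sum[OF t, of x] by (simp flip: sum_distrib_right)
    qed
    show "share t j \<in> borel_measurable borel" if "t \<in> {0..1}" "j \<in> {1..J}" for t j
      unfolding share_def[abs_def] using that
      by (intro borel_measurable_times borel_measurable_divide borel_measurable_const
          cont_diff_in_space_measurable[OF comp_C1] cont_diff_in_space_measurable[OF mix_C1])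
    show "component_velocity (A j) (a j) t \<in> borel_measurable borel" if "t \<in> {0..1}" "j \<in> {1..J}" for t j
      by (rule cont_diff_in_space_measurable[OF cont_diff_in_space_component_velocity[OF A[OF that(2)]] that(1)])
    show "sets (distribution (mix t)) = sets borel" for t by (simp add: distribution_def)
    fix s t :: real and g :: "real ^ 'n \<Rightarrow> real"
    assume st: "0 \<le> s" "s \<le> t" "t \<le> 1" and g: "continuous_on UNIV g" "\<And>x. 0 \<le> g x \<and> g x \<le> 1"
    then have s: "s \<in> {0..1}" and t: "t \<in> {0..1}" by auto
    have g_meas: "g \<in> borel_measurable borel" using g(1) by (rule borel_measurable_continuous_onI)
    \<comment> \<open>Both sides of the one-step formula equal the same weighted sum of integrals
      over the reference law: by \<open>component_path_step\<close>, moving on from time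
      \<open>s\<close> gives the path position at time \<open>t\<close>.\<close>
    have "(\<integral>x. (\<Sum>j = 1..J. share s j x * g (x + (t - s) *\<^sub>R component_velocity (A j) (a j) s x)) \<partial>distribution (mix s)) =
        (\<Sum>j = 1..J. w j * (\<integral>x. g (interp_matrix (A j) t *v x + t *\<^sub>R a j) \<partial>distribution \<rho>))"
    proof (subst integral_mix_sum[OF s, where B = 1])
      fix j assume j: "j \<in> {1..J}"
      show "(\<lambda>x. g (x + (t - s) *\<^sub>R component_velocity (A j) (a j) s x)) \<in> borel_measurable borel"
        by (intro measurable_compose[OF _ g_meas] borel_measurable_add borel_measurable_scaleR
            cont_diff_in_space_measurable[OF cont_diff_in_space_component_velocity[OF A[OF j]] s]) auto
    qed (use g(2) component_path_step[OF A s] in \<open>auto intro!: sum.cong\<close>)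
    then show "(\<integral>x. g x \<partial>distribution (mix t)) =
        (\<integral>x. (\<Sum>j = 1..J. share s j x * g (x + (t - s) *\<^sub>R component_velocity (A j) (a j) s x)) \<partial>distribution (mix s))"
      using integral_mix[OF t g_meas, of 1] g(2) by simp
  qed ((rule finite_atLeastAtMost share_nonneg share_sum vel_eq u prob_space_mix; assumption)+)
qed

lemma mix_0: "mix 0 = \<rho>"
proof -
  have "invertible (mat 1 :: real ^ 'n ^ 'n)" unfolding invertible_def by (rule exI[of _ "mat 1"]) simp
  from matrix_inv_invertible(1)[OF this] have "matrix_inv (mat 1 :: real ^ 'n ^ 'n) = mat 1" by simp
  then have "cden j 0 x = \<rho> x" for j x
    by (simp add: component_density_def affine_density_def interp_matrix_def)
  then show ?thesis using w_sum by (simp add: mixture_density_def fun_eq_iff flip: sum_distrib_right)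
qed

lemma mix_1: "mix 1 = tar_density \<rho> J w a A"
  by (simp add: fun_eq_iff mixture_density_def tar_density_def component_density_def interp_matrix_def)

text \<open>Both claims rest on one interpretation of \<open>superposition\<close>, whose constant
  is only obtained inside the proof. Global solutions exist for every initial value. Testing the
  pushforward against compactly supported functions reduces the transport claim to
  \<open>integral_flow\<close>.\<close>

lemma ode_solution_ex_unique:
  "\<exists>x. ode_solution vel x0 x \<and> (\<forall>y. ode_solution vel x0 y \<longrightarrow> (\<forall>t\<in>{0..1}. y t = x t))"
  and transport_flow_map: "t \<in> {0..1} \<Longrightarrow> transport_map (flow_map vel t) (distribution \<rho>) (distribution (mix t))"
proof -
  obtain C where "superposition vel C {1..J} share (\<lambda>t j. component_velocity (A j) (a j) t) (\<lambda>t. distribution (mix t))"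
    by (rule obtains_superposition) (rule that)
  then interpret S: superposition vel C "{1..J}" share "\<lambda>t j. component_velocity (A j) (a j) t" "\<lambda>t. distribution (mix t)" .
  have sol: "ode_solution vel x0 x \<longleftrightarrow> x 0 = x0 \<and> S.solves 0 1 x" for x0 x
    by (simp add: ode_solution_def S.solves_def)
  have flow_sol: "ode_solution vel x0 (\<lambda>t. S.flow 0 t x0)" for x0
    by (simp add: sol S.flow_solves)
  have uniq: "y t = S.flow 0 t x0" if "ode_solution vel x0 y" "t \<in> {0..1}" for x0 y t
    using that flow_sol[of x0] S.solves_unique[of 0 1 y "\<lambda>t. S.flow 0 t x0" t] by (simp add: sol)
  show "\<exists>x. ode_solution vel x0 x \<and> (\<forall>y. ode_solution vel x0 y \<longrightarrow> (\<forall>t\<in>{0..1}. y t = x t))"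
    using flow_sol uniq by blast
  assume t: "t \<in> {0..1}"
  \<comment> \<open>Uniqueness of solutions makes the definite description in
    \<open>flow_map\<close> denote the value of the flow from time 0.\<close>
  have flow_map: "flow_map vel t = S.flow 0 t"
    unfolding flow_map_def fun_eq_iff using flow_sol uniq t by (intro allI the_equality) auto
  have meas: "S.flow 0 t \<in> borel \<rightarrow>\<^sub>M borel"
    using t by (intro borel_measurable_continuous_onI S.continuous_on_flow) auto
  have meas': "S.flow 0 t \<in> distribution \<rho> \<rightarrow>\<^sub>M borel" using meas by (simp add: distribution_def)
  have "distr (distribution \<rho>) borel (S.flow 0 t) = distribution (mix t)"
  proof (rule borel_measure_eq_by_test_functions)
    show "prob_space (distr (distribution \<rho>) borel (S.flow 0 t))"
      by (intro prob_space.prob_space_distr[OF prob_space_ref] meas')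
    show "prob_space (distribution (mix t))" by (rule prob_space_mix[OF t])
    fix \<psi> :: "real ^ 'n \<Rightarrow> real" and R
    assume \<psi>: "cont_diff_in_space (\<lambda>_. \<psi>)" "0 \<le> R" "\<And>x. norm x > R \<Longrightarrow> \<psi> x = 0" "\<And>x. 0 \<le> \<psi> x \<and> \<psi> x \<le> 1"
    have "\<psi> \<in> borel_measurable borel" using cont_diff_in_space_measurable[OF \<psi>(1), of 0] by simp
    then have "(\<integral>x. \<psi> x \<partial>distr (distribution \<rho>) borel (S.flow 0 t)) = (\<integral>x. \<psi> (S.flow 0 t x) \<partial>distribution (mix 0))"
      unfolding mix_0 by (intro integral_distr meas')
    also have "\<dots> = (\<integral>x. \<psi> x \<partial>distribution (mix t))"
      by (rule S.integral_flow[OF \<psi>(1,3,2,4) t])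
    finally show "(\<integral>x. \<psi> x \<partial>distr (distribution \<rho>) borel (S.flow 0 t)) = (\<integral>x. \<psi> x \<partial>distribution (mix t))" .
  qed (simp_all add: distribution_def)
  \<comment> \<open>Only the sigma-algebra of the target measure enters \<open>distr\<close>, and it
    is the Borel one in both cases.\<close>
  moreover have "distr (distribution \<rho>) (distribution (mix t)) (S.flow 0 t) = distr (distribution \<rho>) borel (S.flow 0 t)"
    by (rule distr_cong) (simp_all add: distribution_def)
  ultimately show "transport_map (flow_map vel t) (distribution \<rho>) (distribution (mix t))"
    unfolding transport_map_def flow_map using meas by (simp add: distribution_def)
qed

end

theorem theorem5p1:
  fixes \<rho>_ref :: "real ^ 'n \<Rightarrow> real"
    and J :: nat
    and w :: "nat \<Rightarrow> real"
    and a :: "nat \<Rightarrow> real ^ 'n"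
    and A :: "nat \<Rightarrow> real ^ 'n ^ 'n"
  assumes "continuously_differentiable \<rho>_ref"
    and "\<And>x. 0 < \<rho>_ref x"
    and "has_bochner_integral lborel \<rho>_ref 1"
    and "integrable lborel (\<lambda>x. norm x * \<rho>_ref x)"
    and "\<And>j. j \<in> {1..J} \<Longrightarrow> sym_pos_def (A j)"
    and "\<And>j. j \<in> {1..J} \<Longrightarrow> 0 \<le> w j"
    and "(\<Sum>j = 1..J. w j) = 1"
  shows "let v = mixture_velocity \<rho>_ref J w a A;
             P_ref = distribution \<rho>_ref;
             P_tar = distribution (tar_density \<rho>_ref J w a A);
             P = (\<lambda>t. distribution (mixture_density \<rho>_ref J w a A t))
         in prob_space P_ref \<and> prob_space P_tar \<and> (\<forall>t\<in>{0..1}. prob_space (P t)) \<and>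
            (AE x0 in P_ref. \<exists>x. ode_solution v x0 x \<and>
               (\<forall>y. ode_solution v x0 y \<longrightarrow> (\<forall>t\<in>{0..1}. y t = x t))) \<and>
            (\<forall>t\<in>{0..1}. transport_map (flow_map v t) P_ref (P t)) \<and>
            transport_map (flow_map v 1) P_ref P_tar"
proof -
  interpret affine_mixture \<rho>_ref J w a A
    by unfold_locales (use assms in auto)
  show ?thesis
    \<comment> \<open>The target law is the mixture at time 1, so its claims are instances of those
      for \<open>t\<close>; the almost-everywhere statement holds at every point.\<close>
    unfolding Let_def mix_1[symmetric]
    by (intro conjI ballI AE_I2 prob_space_ref prob_space_mix ode_solution_ex_unique transport_flow_map) simp_all
qed

end
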